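(* Let $K$ be an uncountable algebraically closed field of characteristic $0$, $R=K[x_1,\ldots,x_m]$, and let $1\le g\le m-2$. Then: (1) If $P\in\mathcal{S}_g(t_0)$ for some $t_0\ge1$, then $C^P_g(t)\subseteq C^P_g(t+1)$ for all $t\ge1$, and $\bigcup_{t\ge1}C^P_g(t)=\operatorname{Spec}_{g+1}(R)\cap V(P)$. (2) $\mathcal{S}_g(t)\subseteq\mathcal{S}_g(t+1)$ for all $t\ge1$, and $\bigcup_{t\ge1}\mathcal{S}_g(t)=\operatorname{Spec}_g(R)$.
   Context: For each $g$, $\operatorname{Spec}_g(R)=\{P\in\operatorname{Spec}(R)\mid \operatorname{height}P=g\}$, and $V(P)$ is the set of primes of $R$ containing $P$. For integers $g$ and $t\ge1$, $H_g(t)$ is the set of prime ideals $P$ of $R$ with $\operatorname{height}(P)=g$ such that $P=\sqrt{J}$ for some ideal $J=(f_1,\ldots,f_m)$ generated by $m$ polynomials (where $m$ is the number of variables of $R$) with $\deg(f_j)\le t$ for all $j$. The sets $\mathcal{S}_g(t)$, $1\le g\le m-1$, $t\ge1$, are defined by descending induction on $g$: $\mathcal{S}_{m-1}(t):=H_{m-1}(t)$; and if $\mathcal{S}_{g+1}(t)$ is defined for some $1\le g\le m-2$, then for a prime $P$ of height $g$ put $$C^P_g(t):=\{Q\in\mathcal{S}_{g+1}(t)\mid Q\supsetneq P\}$$ and $$\mathcal{S}_g(t):=\{P\in H_g(t)\mid C^P_g(t)\text{ is uncountable}\}.$$ *)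

theory Defs
  imports
    "HOL-Algebra.Ideal"
    "HOL-Library.Poly_Mapping"
    "HOL-Library.Countable_Set"
    "HOL-Library.Extended_Nat"
    "HOL-Computational_Algebra.Polynomial"
begin

text \<open>A polynomial is a finitely supported map from exponent vectors to coefficients; an exponent
  vector is a finitely supported map from variable indices to exponents.\<close>

type_synonym 'k mpoly = "(nat \<Rightarrow>\<^sub>0 nat) \<Rightarrow>\<^sub>0 'k"

text \<open>The polynomial ring in the variables with indices \<open>1, \<dots>, m\<close>, as a subring of the
  polynomials in countably many variables.\<close>

definition mpoly_ring :: "nat \<Rightarrow> ('k::comm_ring_1) mpoly ring" where
  "mpoly_ring m = \<lparr>
     carrier = {p. \<forall>u \<in> Poly_Mapping.keys p. Poly_Mapping.keys u \<subseteq> {1..m}},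
     monoid.mult = (*), one = 1, ring.zero = 0, add = (+)\<rparr>"

lemma mpoly_ring_simps [simp]:
  "carrier (mpoly_ring m) = {p. \<forall>u \<in> Poly_Mapping.keys p. Poly_Mapping.keys u \<subseteq> {1..m}}"
  "x \<otimes>\<^bsub>mpoly_ring m\<^esub> y = x * y" "x \<oplus>\<^bsub>mpoly_ring m\<^esub> y = x + y"
  "\<one>\<^bsub>mpoly_ring m\<^esub> = 1" "\<zero>\<^bsub>mpoly_ring m\<^esub> = 0"
  by (simp_all add: mpoly_ring_def)

lemma cring_mpoly_ring: "cring (mpoly_ring m :: ('k::comm_ring_1) mpoly ring)"
proof (rule cringI)
  show "abelian_group (mpoly_ring m :: 'k mpoly ring)"
  proof (rule abelian_groupI)
    fix x y :: "'k mpoly"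
    assume "x \<in> carrier (mpoly_ring m)" "y \<in> carrier (mpoly_ring m)"
    then show "x \<oplus>\<^bsub>mpoly_ring m\<^esub> y \<in> carrier (mpoly_ring m)"
      using Poly_Mapping.keys_add[of x y] by auto
  next
    fix x :: "'k mpoly"
    assume x: "x \<in> carrier (mpoly_ring m)"
    have "Poly_Mapping.keys (- x) = Poly_Mapping.keys x"
      by (auto simp: in_keys_iff)
    with x have "- x \<in> carrier (mpoly_ring m)" by simp
    then show "\<exists>y\<in>carrier (mpoly_ring m). y \<oplus>\<^bsub>mpoly_ring m\<^esub> x = \<zero>\<^bsub>mpoly_ring m\<^esub>"
      by (intro bexI[of _ "- x"]) auto
  qed (auto simp: algebra_simps)
next
  show "comm_monoid (mpoly_ring m :: 'k mpoly ring)"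
  proof (rule comm_monoidI)
    fix x y :: "'k mpoly"
    assume xy: "x \<in> carrier (mpoly_ring m)" "y \<in> carrier (mpoly_ring m)"
    have "Poly_Mapping.keys w \<subseteq> {1..m}" if "w \<in> Poly_Mapping.keys (x * y)" for w
    proof -
      from that obtain u v where "u \<in> Poly_Mapping.keys x" "v \<in> Poly_Mapping.keys y" "w = u + v"
        using Poly_Mapping.keys_mult[of x y] by auto
      with xy show ?thesis using Poly_Mapping.keys_add[of u v] by fastforce
    qed
    then show "x \<otimes>\<^bsub>mpoly_ring m\<^esub> y \<in> carrier (mpoly_ring m)" by simp
  qed (auto simp: algebra_simps)
qed (auto simp: algebra_simps)

text \<open>Total degree. The zero polynomial is given degree \<open>0\<close>; since the degree bounds below are
  all at least \<open>1\<close>, this agrees with the convention \<open>-\<infinity>\<close>.\<close>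

definition total_degree :: "('k::zero) mpoly \<Rightarrow> nat" where
  "total_degree p =
     Max (insert 0 ((\<lambda>u. \<Sum>i\<in>Poly_Mapping.keys u. Poly_Mapping.lookup u i) ` Poly_Mapping.keys p))"

definition ideal_radical :: "('a, 'b) ring_scheme \<Rightarrow> 'a set \<Rightarrow> 'a set" where
  "ideal_radical R J = {a \<in> carrier R. \<exists>n::nat. a [^]\<^bsub>R\<^esub> n \<in> J}"

definition Spec :: "('a, 'b) ring_scheme \<Rightarrow> 'a set set" where
  "Spec R = {P. primeideal P R}"

text \<open>The height is the supremum of the lengths \<open>n\<close> of chains
  \<open>c 0 \<subset> \<dots> \<subset> c n = P\<close> of prime ideals.\<close>

definition height :: "('a, 'b) ring_scheme \<Rightarrow> 'a set \<Rightarrow> enat" where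
  "height R P =
     Sup {enat n | n. \<exists>c. (\<forall>i\<le>n. c i \<in> Spec R) \<and> (\<forall>i<n. c i \<subset> c (Suc i)) \<and> c n = P}"

definition Spec_ht :: "('a, 'b) ring_scheme \<Rightarrow> nat \<Rightarrow> 'a set set" where
  "Spec_ht R g = {P \<in> Spec R. height R P = enat g}"

definition V :: "('a, 'b) ring_scheme \<Rightarrow> 'a set \<Rightarrow> 'a set set" where
  "V R P = {Q \<in> Spec R. P \<subseteq> Q}"

definition H :: "nat \<Rightarrow> nat \<Rightarrow> nat \<Rightarrow> ('k::comm_ring_1) mpoly set set" where
  "H m g t = {P \<in> Spec_ht (mpoly_ring m) g.
     \<exists>f :: nat \<Rightarrow> 'k mpoly.
       (\<forall>j\<in>{1..m}. f j \<in> carrier (mpoly_ring m) \<and> total_degree (f j) \<le> t) \<and>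
       P = ideal_radical (mpoly_ring m) (Idl\<^bsub>mpoly_ring m\<^esub> (f ` {1..m}))}"

text \<open>Descending recursion on \<open>g\<close>. Only the range \<open>1 \<le> g \<le> m - 1\<close> is meaningful. The set whose
  uncountability is required is \<open>C m g t P\<close> below.\<close>

function S :: "nat \<Rightarrow> nat \<Rightarrow> nat \<Rightarrow> ('k::comm_ring_1) mpoly set set" where
  "S m g t =
     (if g + 1 = m then H m g t
      else if g + 1 < m then {P \<in> H m g t. uncountable {Q \<in> S m (g + 1) t. P \<subset> Q}}
      else {})"
  by auto
termination by (relation "measure (\<lambda>(m, g, t). m - g)") auto

declare S.simps [simp del]

definition C :: "nat \<Rightarrow> nat \<Rightarrow> nat \<Rightarrow> ('k::comm_ring_1) mpoly set \<Rightarrow> 'k mpoly set set" where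
  "C m g t P = {Q \<in> S m (g + 1) t. P \<subset> Q}"

lemma S_top: "g + 1 = m \<Longrightarrow> S m g t = H m g t"
  by (subst S.simps) simp

lemma S_step: "g + 1 < m \<Longrightarrow> S m g t = {P \<in> H m g t. uncountable (C m g t P)}"
  by (subst S.simps) (simp add: C_def)

end

theory Submission
  imports Defs
begin

text \<open>Everything reduces to two facts about \<open>R = K[x\<^sub>1, \<dots>, x\<^sub>m]\<close>: every prime is the radical of an ideal
  generated by \<open>m\<close> elements, and a non-maximal prime of height \<open>g\<close> is contained in uncountably
  many primes of height \<open>g + 1\<close>. The first gives \<open>\<Union>\<^sub>t H\<^sub>g(t) = Spec\<^sub>g(R)\<close>. By descending
  induction on \<open>g\<close>, \<open>\<Union>\<^sub>t C\<^sub>g\<^sup>P(t)\<close> is the set of all primes of height \<open>g + 1\<close> above \<open>P\<close>, so by the second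
  fact one of these countably many sets is uncountable and \<open>P\<close> lies in some \<open>S\<^sub>g(t)\<close>.

  Heights are computed from the transcendence degree of \<open>R / P\<close>, which strictly drops along
  inclusions of primes: if \<open>f\<^sub>1, \<dots>, f\<^sub>d\<close> are algebraically independent modulo \<open>Q \<supset> P\<close> and
  \<open>h \<in> Q - P\<close>, then \<open>f\<^sub>1, \<dots>, f\<^sub>d, h\<close> are algebraically independent modulo \<open>P\<close>.\<close>

section \<open>Ideals, noetherian rings and the Hilbert basis theorem\<close>

text \<open>Kronecker's argument generates ideals of \<open>R\<close> up to radical by
  \<open>m + 1\<close> elements, one too many for \<open>H\<close>. The saving comes from splitting
  off one variable, with \<open>B = K[x_1, ..., x_(m-1)]\<close>: over the generic point of a prime
  \<open>p\<close> of \<open>B\<close>, the ring \<open>R\<close> becomes a polynomial ring in one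
  variable over a field, where ideals are principal. So one element settles the generic part over
  finitely many primes of \<open>B\<close> at once, and what remains lies over primes of smaller
  rank. Ranks in \<open>B\<close> are at most \<open>m - 1\<close>, hence \<open>m\<close> rounds
  are enough. Rings and ideals are subsets of one ambient type. The rings
  \<open>K[x_1, ..., x_n]\<close> are then nested sets, induction on \<open>n\<close> stays within
  one type, and quotients are replaced by statements modulo an ideal. In the last step
  \<open>P\<close> must belong to \<open>H\<close> for the same \<open>t\<close> for which
  \<open>C\<close> is uncountable. Therefore monotonicity in \<open>t\<close> is proved before
  exhaustion.\<close>

definition is_subring :: "'a::comm_ring_1 set \<Rightarrow> bool" where
  "is_subring A \<longleftrightarrow> 0 \<in> A \<and> 1 \<in> A \<and> (\<forall>x\<in>A. - x \<in> A) \<and>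
     (\<forall>x\<in>A. \<forall>y\<in>A. x + y \<in> A \<and> x * y \<in> A)"

definition ideal_in :: "'a::comm_ring_1 set \<Rightarrow> 'a set \<Rightarrow> bool" where
  "ideal_in A I \<longleftrightarrow> I \<subseteq> A \<and> 0 \<in> I \<and> (\<forall>x\<in>I. \<forall>y\<in>I. x + y \<in> I) \<and> (\<forall>a\<in>A. \<forall>x\<in>I. a * x \<in> I)"

definition prime_in :: "'a::comm_ring_1 set \<Rightarrow> 'a set \<Rightarrow> bool" where
  "prime_in A P \<longleftrightarrow> ideal_in A P \<and> 1 \<notin> P \<and> (\<forall>a\<in>A. \<forall>b\<in>A. a * b \<in> P \<longrightarrow> a \<in> P \<or> b \<in> P)"

definition noetherian_in :: "'a::comm_ring_1 set \<Rightarrow> bool" where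
  "noetherian_in A \<longleftrightarrow> (\<forall>I :: nat \<Rightarrow> 'a set. (\<forall>n. ideal_in A (I n)) \<longrightarrow> (\<forall>n. I n \<subseteq> I (Suc n)) \<longrightarrow>
     (\<exists>N. \<forall>n\<ge>N. I n = I N))"

lemma is_subringD:
  assumes "is_subring A"
  shows "0 \<in> A" "1 \<in> A" "x \<in> A \<Longrightarrow> - x \<in> A" "x \<in> A \<Longrightarrow> y \<in> A \<Longrightarrow> x + y \<in> A"
    "x \<in> A \<Longrightarrow> y \<in> A \<Longrightarrow> x * y \<in> A" "x \<in> A \<Longrightarrow> y \<in> A \<Longrightarrow> x - y \<in> A"
    "x \<in> A \<Longrightarrow> x ^ n \<in> A"
proof -
  show "x \<in> A \<Longrightarrow> y \<in> A \<Longrightarrow> x - y \<in> A"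
    using assms unfolding is_subring_def by (metis diff_conv_add_uminus)
  show "x \<in> A \<Longrightarrow> x ^ n \<in> A"
    using assms unfolding is_subring_def by (induction n) auto
qed (use assms in \<open>auto simp: is_subring_def\<close>)

lemma is_subring_sum:
  assumes "is_subring A" "\<And>i. i \<in> X \<Longrightarrow> f i \<in> A"
  shows "sum f X \<in> A"
  using assms(2) by (induction X rule: infinite_finite_induct) (auto intro: is_subringD[OF assms(1)])

lemma is_subring_prod:
  assumes "is_subring A" "\<And>i. i \<in> X \<Longrightarrow> f i \<in> A"
  shows "prod f X \<in> A"
  using assms(2) by (induction X rule: infinite_finite_induct) (auto intro: is_subringD[OF assms(1)])

lemma ideal_inD:
  assumes "ideal_in A I"
  shows "I \<subseteq> A" "x \<in> I \<Longrightarrow> x \<in> A" "0 \<in> I" "x \<in> I \<Longrightarrow> y \<in> I \<Longrightarrow> x + y \<in> I"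
    "a \<in> A \<Longrightarrow> x \<in> I \<Longrightarrow> a * x \<in> I" "a \<in> A \<Longrightarrow> x \<in> I \<Longrightarrow> x * a \<in> I"
  using assms unfolding ideal_in_def by (auto simp: mult.commute)

lemma ideal_in_uminus:
  assumes "is_subring A" "ideal_in A I" "x \<in> I"
  shows "- x \<in> I"
  using ideal_inD(5)[OF assms(2), of "- 1" x] assms is_subringD(2,3)[OF assms(1)] by auto

lemma ideal_in_diff:
  assumes "is_subring A" "ideal_in A I" "x \<in> I" "y \<in> I"
  shows "x - y \<in> I"
  using ideal_inD(4)[OF assms(2,3) ideal_in_uminus[OF assms(1,2,4)]] by simp

lemma ideal_in_add_cancel:
  assumes "is_subring A" "ideal_in A I" "y \<in> I"
  shows "x + y \<in> I \<longleftrightarrow> x \<in> I"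
  using ideal_in_diff[OF assms(1,2), of "x + y" y] ideal_inD(4)[OF assms(2), of x y] assms(3) by auto

lemma ideal_in_sum:
  assumes "ideal_in A I" "\<And>i. i \<in> X \<Longrightarrow> f i \<in> I"
  shows "sum f X \<in> I"
  using assms(2) by (induction X rule: infinite_finite_induct) (auto intro: ideal_inD[OF assms(1)])

lemma ideal_in_Int_subring:
  assumes "ideal_in A I" "B \<subseteq> A" "is_subring B"
  shows "ideal_in B (I \<inter> B)"
  using assms unfolding ideal_in_def is_subring_def by auto

lemma prime_inD:
  assumes "prime_in A P"
  shows "ideal_in A P" "1 \<notin> P" "a \<in> A \<Longrightarrow> b \<in> A \<Longrightarrow> a * b \<in> P \<Longrightarrow> a \<in> P \<or> b \<in> P"
  using assms unfolding prime_in_def by auto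

lemma prime_in_Int_subring:
  assumes "prime_in A P" "is_subring B" "B \<subseteq> A"
  shows "prime_in B (P \<inter> B)"
  using assms(3) ideal_in_Int_subring[OF prime_inD(1)[OF assms(1)] assms(3,2)] prime_inD(2,3)[OF assms(1)]
    is_subringD(2)[OF assms(2)]
  unfolding prime_in_def by (simp add: subset_iff)

lemma prime_in_power:
  assumes "is_subring A" "prime_in A P" "a \<in> A" "a ^ n \<in> P"
  shows "a \<in> P"
  using assms(4)
proof (induction n)
  case 0
  then show ?case using prime_inD(2)[OF assms(2)] by simp
next
  case (Suc n)
  then show ?case using prime_inD(3)[OF assms(2,3), of "a ^ n"] is_subringD(7)[OF assms(1,3)] by auto
qed

section \<open>Maximality arguments: avoiding a multiplicative set, finitely many primes over an
  ideal\<close>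

lemma noetherian_in_maximal:
  assumes "noetherian_in A" "F \<noteq> {}" "\<And>I. I \<in> F \<Longrightarrow> ideal_in A I"
  shows "\<exists>I\<in>F. \<forall>J\<in>F. I \<subseteq> J \<longrightarrow> J = I"
proof (rule ccontr)
  assume no: "\<not> ?thesis"
  have step: "\<exists>J. J \<in> F \<and> I \<subset> J" if "I \<in> F" for I
    using no that by blast
  have "\<exists>c. \<forall>n::nat. c n \<in> F \<and> c n \<subset> c (Suc n)"
    using assms(2) step by (intro dependent_nat_choice) auto
  then obtain c where c: "\<And>n. c n \<in> F" "\<And>n::nat. c n \<subset> c (Suc n)"
    by blast
  have "\<forall>n. ideal_in A (c n)" "\<forall>n. c n \<subseteq> c (Suc n)"
    using c assms(3) by blast+
  then obtain N where N: "\<forall>n\<ge>N. c n = c N"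
    using assms(1) unfolding noetherian_in_def by blast
  have "c (Suc N) = c N" using N[rule_format, of "Suc N"] by simp
  with c(2)[of N] show False by auto
qed

definition adjoin :: "'a::comm_ring_1 set \<Rightarrow> 'a set \<Rightarrow> 'a \<Rightarrow> 'a set" where
  "adjoin A I t = {x + a * t | x a. x \<in> I \<and> a \<in> A}"

lemma ideal_in_adjoin:
  assumes "is_subring A" "ideal_in A I" "t \<in> A"
  shows "ideal_in A (adjoin A I t)"
  unfolding ideal_in_def
proof (intro conjI ballI)
  note A = is_subringD[OF assms(1)] and I = ideal_inD[OF assms(2)]
  show "adjoin A I t \<subseteq> A"
    unfolding adjoin_def using A I assms(3) by auto
  show "0 \<in> adjoin A I t"
    unfolding adjoin_def using I(3) A(1) by force
  fix x assume "x \<in> adjoin A I t"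
  then obtain u a where x: "x = u + a * t" "u \<in> I" "a \<in> A" unfolding adjoin_def by auto
  {
    fix y assume "y \<in> adjoin A I t"
    then obtain v b where y: "y = v + b * t" "v \<in> I" "b \<in> A" unfolding adjoin_def by auto
    have "x + y = (u + v) + (a + b) * t" using x y by (simp add: algebra_simps)
    moreover have "u + v \<in> I" "a + b \<in> A" using x y A(4) I(4) by auto
    ultimately show "x + y \<in> adjoin A I t" unfolding adjoin_def by blast
  }
  {
    fix b assume b: "b \<in> A"
    have "b * x = b * u + (b * a) * t" using x by (simp add: algebra_simps)
    moreover have "b * u \<in> I" "b * a \<in> A" using x b A(5) I(5) by auto
    ultimately show "b * x \<in> adjoin A I t" unfolding adjoin_def by blast
  }
qed

lemma adjoin_superset:
  assumes "is_subring A" "ideal_in A I"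
  shows "I \<subseteq> adjoin A I t" "t \<in> adjoin A I t"
proof -
  show "I \<subseteq> adjoin A I t"
  proof
    fix x assume "x \<in> I"
    then show "x \<in> adjoin A I t"
      unfolding adjoin_def using is_subringD(1)[OF assms(1)] by force
  qed
  show "t \<in> adjoin A I t"
    unfolding adjoin_def using is_subringD(2)[OF assms(1)] ideal_inD(3)[OF assms(2)]
    by force
qed

lemma adjoin_least:
  assumes "ideal_in A J" "I \<subseteq> J" "t \<in> J"
  shows "adjoin A I t \<subseteq> J"
  unfolding adjoin_def using assms ideal_inD[OF assms(1)] by auto

text \<open>An ideal maximal among those that contain \<open>I\<close> and miss \<open>M\<close> is
  prime: for \<open>a\<close>, \<open>b\<close> outside it, \<open>P + (a)\<close> and
  \<open>P + (b)\<close> contain elements of \<open>M\<close>, whose product lies in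
  \<open>M\<close> and, if \<open>a * b\<close> is in \<open>P\<close>, also in \<open>P\<close>.
  Used with the powers of one element to recognise radicals, and with the nonzero polynomials in
  \<open>f 1, ..., f d\<close> to keep these independent.\<close>

lemma exists_prime_avoiding:
  assumes A: "is_subring A" "noetherian_in A" and I: "ideal_in A I"
    and M: "1 \<in> M" "\<And>a b. a \<in> M \<Longrightarrow> b \<in> M \<Longrightarrow> a * b \<in> M" and IM: "I \<inter> M = {}"
  obtains P where "prime_in A P" "I \<subseteq> P" "P \<inter> M = {}"
proof -
  let ?F = "{J. ideal_in A J \<and> I \<subseteq> J \<and> J \<inter> M = {}}"
  have "\<exists>P\<in>?F. \<forall>J\<in>?F. P \<subseteq> J \<longrightarrow> J = P"
    by (rule noetherian_in_maximal[OF A(2)]) (use I IM in auto)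
  then obtain P where P: "P \<in> ?F" and max: "\<forall>J\<in>?F. P \<subseteq> J \<longrightarrow> J = P"
    by (rule bexE)
  have id: "ideal_in A P" using P by simp
  have meet: "\<exists>x\<in>P. \<exists>r\<in>A. x + r * a \<in> M" if "a \<in> A" "a \<notin> P" for a
  proof -
    have "adjoin A P a \<notin> ?F"
    proof
      assume "adjoin A P a \<in> ?F"
      with max adjoin_superset(1)[OF A(1) id] have "adjoin A P a = P" by simp
      with adjoin_superset(2)[OF A(1) id, of a] that(2) show False by simp
    qed
    then have "adjoin A P a \<inter> M \<noteq> {}"
      using ideal_in_adjoin[OF A(1) id that(1)] adjoin_superset(1)[OF A(1) id, of a] P by auto
    then show ?thesis unfolding adjoin_def by auto
  qed
  have "a \<in> P \<or> b \<in> P" if ab: "a \<in> A" "b \<in> A" "a * b \<in> P" for a b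
  proof (rule ccontr)
    assume "\<not> (a \<in> P \<or> b \<in> P)"
    with meet ab obtain x r y s where *: "x \<in> P" "r \<in> A" "x + r * a \<in> M" "y \<in> P" "s \<in> A" "y + s * b \<in> M"
      by metis
    have "(x + r * a) * (y + s * b) = (y + s * b) * x + (r * a) * y + (r * s) * (a * b)"
      by (simp add: algebra_simps)
    also have "\<dots> \<in> P"
      using * ab is_subringD[OF A(1)] ideal_inD[OF id] by simp
    finally show False using M(2) * P by blast
  qed
  then have "prime_in A P" using id M(1) P unfolding prime_in_def by auto
  then show thesis using P that by auto
qed

text \<open>Noetherian induction. A maximal counterexample is proper and not prime, so it contains
  some \<open>a * b\<close> with \<open>a\<close>, \<open>b\<close> outside; every prime over it
  contains \<open>a\<close> or \<open>b\<close>, and the finite sets for the two enlarged ideals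
  together serve it. \<open>F\<close> may contain non-minimal primes; what counts is that each prime
  over \<open>I\<close> contains a member.\<close>

lemma finitely_many_minimal_primes:
  assumes A: "is_subring A" "noetherian_in A" and I: "ideal_in A I"
  obtains F where "finite F" "\<And>p. p \<in> F \<Longrightarrow> prime_in A p \<and> I \<subseteq> p"
    "\<And>Q. prime_in A Q \<Longrightarrow> I \<subseteq> Q \<Longrightarrow> \<exists>p\<in>F. p \<subseteq> Q"
proof -
  define good where "good I \<longleftrightarrow> (\<exists>F. finite F \<and> (\<forall>p\<in>F. prime_in A p \<and> I \<subseteq> p) \<and>
    (\<forall>Q. prime_in A Q \<longrightarrow> I \<subseteq> Q \<longrightarrow> (\<exists>p\<in>F. p \<subseteq> Q)))" for I
  have "good I"
  proof (rule ccontr)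
    assume "\<not> good I"
    with I have "{J. ideal_in A J \<and> \<not> good J} \<noteq> {}" by blast
    from noetherian_in_maximal[OF A(2) this] obtain J where J: "ideal_in A J" "\<not> good J"
      and max: "\<And>J'. ideal_in A J' \<Longrightarrow> \<not> good J' \<Longrightarrow> J \<subseteq> J' \<Longrightarrow> J' = J"
      by blast
    \<comment> \<open>A prime \<open>J\<close> would be served by \<open>{J}\<close>, the unit ideal
      by the empty set.\<close>
    have "\<not> prime_in A J" using J(2) unfolding good_def
      by (auto dest!: spec[of _ "{J}"])
    moreover have "1 \<notin> J"
    proof
      assume "1 \<in> J"
      then have "good J" unfolding good_def using prime_inD(2) by (intro exI[of _ "{}"]) auto
      with J(2) show False by simp
    qed
    ultimately obtain a b where ab: "a \<in> A" "b \<in> A" "a * b \<in> J" "a \<notin> J" "b \<notin> J"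
      using J(1) unfolding prime_in_def by auto
    have "good (adjoin A J c)" if "c \<in> A" "c \<notin> J" for c
      using max[of "adjoin A J c"] ideal_in_adjoin[OF A(1) J(1) that(1)] adjoin_superset[OF A(1) J(1), of c] that(2)
      by auto
    with ab have "good (adjoin A J a)" "good (adjoin A J b)" by auto
    then obtain F G where F: "finite F" "\<forall>p\<in>F. prime_in A p \<and> adjoin A J a \<subseteq> p"
        "\<forall>Q. prime_in A Q \<longrightarrow> adjoin A J a \<subseteq> Q \<longrightarrow> (\<exists>p\<in>F. p \<subseteq> Q)"
      and G: "finite G" "\<forall>p\<in>G. prime_in A p \<and> adjoin A J b \<subseteq> p"
        "\<forall>Q. prime_in A Q \<longrightarrow> adjoin A J b \<subseteq> Q \<longrightarrow> (\<exists>p\<in>G. p \<subseteq> Q)"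
      unfolding good_def by auto
    have "good J" unfolding good_def
    proof (intro exI[of _ "F \<union> G"] conjI allI impI)
      show "finite (F \<union> G)" using F G by simp
      show "\<forall>p\<in>F \<union> G. prime_in A p \<and> J \<subseteq> p"
        using F(2) G(2) adjoin_superset(1)[OF A(1) J(1)] by blast
      fix Q assume Q: "prime_in A Q" "J \<subseteq> Q"
      then have "a \<in> Q \<or> b \<in> Q" using prime_inD(3)[OF Q(1) ab(1,2)] ab(3) by auto
      then have "adjoin A J a \<subseteq> Q \<or> adjoin A J b \<subseteq> Q"
        using adjoin_least[OF prime_inD(1)[OF Q(1)] Q(2)] by auto
      then show "\<exists>p\<in>F \<union> G. p \<subseteq> Q"
        using F(3)[rule_format, OF Q(1)] G(3)[rule_format, OF Q(1)] by auto
    qed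
    with J(2) show False by simp
  qed
  then show thesis using that unfolding good_def by auto
qed

section \<open>Univariate polynomials over a subring and the Hilbert basis theorem\<close>

definition polys_over :: "'a::comm_ring_1 set \<Rightarrow> 'a poly set" where
  "polys_over B = {q. \<forall>k. coeff q k \<in> B}"

lemma monom_polys_over: "a \<in> B \<Longrightarrow> 0 \<in> B \<Longrightarrow> monom a k \<in> polys_over B"
  by (auto simp: polys_over_def)

lemma is_subring_polys_over:
  assumes "is_subring B"
  shows "is_subring (polys_over B)"
  unfolding is_subring_def polys_over_def
  using is_subringD[OF assms]
  by (auto simp: coeff_mult coeff_1 intro!: is_subring_sum[OF assms])

lemma ideal_in_polys_over:
  assumes "ideal_in B I"
  shows "ideal_in (polys_over B) (polys_over I)"
  unfolding ideal_in_def polys_over_def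
  using ideal_inD[OF assms]
  by (auto simp: coeff_mult intro!: ideal_in_sum[OF assms])

definition lead_ideal :: "'a::comm_ring_1 poly set \<Rightarrow> nat \<Rightarrow> 'a set" where
  "lead_ideal I k = {coeff f k | f. f \<in> I \<and> degree f \<le> k}"

lemma ideal_in_lead_ideal:
  assumes B: "is_subring B" and I: "ideal_in (polys_over B) I"
  shows "ideal_in B (lead_ideal I k)"
  unfolding ideal_in_def
proof (intro conjI ballI)
  note I' = ideal_inD[OF I]
  show "lead_ideal I k \<subseteq> B"
    using I'(1) unfolding lead_ideal_def polys_over_def by auto
  show "0 \<in> lead_ideal I k" unfolding lead_ideal_def using I'(3) by force
  fix x assume "x \<in> lead_ideal I k"
  then obtain f where f: "f \<in> I" "degree f \<le> k" "x = coeff f k" unfolding lead_ideal_def by auto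
  {
    fix y assume "y \<in> lead_ideal I k"
    then obtain g where g: "g \<in> I" "degree g \<le> k" "y = coeff g k" unfolding lead_ideal_def by auto
    show "x + y \<in> lead_ideal I k" unfolding lead_ideal_def
      using f g I'(4)[of f g] degree_add_le[OF f(2) g(2)] by (intro CollectI exI[of _ "f + g"]) auto
  }
  {
    fix a assume "a \<in> B"
    then have "[:a:] \<in> polys_over B"
      using is_subringD(1)[OF B] by (auto simp: polys_over_def coeff_pCons split: nat.split)
    then have "[:a:] * f \<in> I"
      using I'(5) f(1) by blast
    then show "a * x \<in> lead_ideal I k" unfolding lead_ideal_def
      using f degree_smult_le[of a f] by (intro CollectI exI[of _ "smult a f"]) auto
  }
qed

lemma lead_ideal_mono: "I \<subseteq> J \<Longrightarrow> lead_ideal I k \<subseteq> lead_ideal J k"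
  unfolding lead_ideal_def by auto

lemma lead_ideal_Suc:
  assumes B: "is_subring B" and I: "ideal_in (polys_over B) I"
  shows "lead_ideal I k \<subseteq> lead_ideal I (Suc k)"
proof
  fix x assume "x \<in> lead_ideal I k"
  then obtain f where f: "f \<in> I" "degree f \<le> k" "x = coeff f k" unfolding lead_ideal_def by auto
  have "monom 1 1 * f \<in> I"
    using ideal_inD(5)[OF I] f(1) is_subringD[OF B] by (simp add: monom_polys_over)
  moreover have "coeff (monom 1 1 * f) (Suc k) = x" "degree (monom 1 1 * f) \<le> Suc k"
    using f degree_mult_le[of "monom (1::'a) 1" f] degree_monom_le[of "1::'a" 1]
    by (auto simp: coeff_monom_mult)
  ultimately show "x \<in> lead_ideal I (Suc k)" unfolding lead_ideal_def by blast
qed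

text \<open>Induction on a degree bound: from \<open>f\<close> in \<open>J\<close>, subtract an
  element of \<open>I\<close> with the same coefficient in the top degree.\<close>

lemma ideal_eq_if_lead_ideals_eq:
  assumes B: "is_subring B" and I: "ideal_in (polys_over B) I" and J: "ideal_in (polys_over B) J"
    and sub: "I \<subseteq> J" and eq: "\<And>k. lead_ideal J k \<subseteq> lead_ideal I k"
  shows "J = I"
proof -
  have "f \<in> I" if "f \<in> J" "degree f < n" for f n
    using that
  proof (induction n arbitrary: f)
    case 0
    then show ?case by simp
  next
    case (Suc n)
    then have "coeff f n \<in> lead_ideal J n" unfolding lead_ideal_def by auto
    with eq obtain g where g: "g \<in> I" "degree g \<le> n" "coeff f n = coeff g n"
      unfolding lead_ideal_def by blast
    have d: "f - g \<in> J"
      using ideal_in_diff[OF is_subring_polys_over[OF B] J] g sub Suc by auto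
    \<comment> \<open>The difference may vanish, and \<open>degree 0 = 0\<close> is not below
      \<open>n\<close> when \<open>n = 0\<close>.\<close>
    have "degree (f - g) < n \<or> f = g"
    proof (cases "f = g")
      case False
      have "degree (f - g) \<le> n" using g Suc by (intro degree_diff_le) auto
      moreover have "degree (f - g) \<noteq> n"
        using g(3) False leading_coeff_0_iff[of "f - g"] by auto
      ultimately show ?thesis by simp
    qed simp
    then show ?case
    proof
      assume "degree (f - g) < n"
      then have "f - g \<in> I" using Suc.IH d by blast
      then show "f \<in> I" using ideal_inD(4)[OF I _ g(1), of "f - g"] by simp
    qed (use g in simp)
  qed
  then show ?thesis using sub by blast
qed

lemma stationary_max:
  fixes L :: "nat \<Rightarrow> nat \<Rightarrow> 'b set"
  assumes "\<And>k. \<exists>N. \<forall>n\<ge>N. L k n = L k N"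
  shows "\<exists>N. \<forall>k<M. \<forall>n\<ge>N. L k n = L k N"
proof (induction M)
  case (Suc M)
  then obtain N where N: "\<forall>k<M. \<forall>n\<ge>N. L k n = L k N" by auto
  obtain N' where N': "\<forall>n\<ge>N'. L M n = L M N'" using assms by blast
  have "\<forall>k<Suc M. \<forall>n\<ge>max N N'. L k n = L k (max N N')"
  proof (intro allI impI)
    fix k n assume "k < Suc M" "n \<ge> max N N'"
    then show "L k n = L k (max N N')"
      using N[rule_format, of k n] N[rule_format, of k "max N N'"]
        N'[rule_format, of n] N'[rule_format, of "max N N'"] by (cases "k = M") auto
  qed
  then show ?case by blast
qed simp

text \<open>\<open>L k n\<close> grows in both indices. Stability of the diagonal from
  \<open>M\<close> on settles all rows \<open>k\<close> with \<open>k >= M\<close> at once; this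
  leaves finitely many rows, each of which becomes stationary on its own.\<close>

theorem hilbert_basis:
  assumes B: "is_subring B" "noetherian_in B"
  shows "noetherian_in (polys_over B)"
  unfolding noetherian_in_def
proof (intro allI impI)
  fix I :: "nat \<Rightarrow> 'a poly set"
  assume I: "\<forall>n. ideal_in (polys_over B) (I n)" and inc: "\<forall>n. I n \<subseteq> I (Suc n)"
  define L where "L k n = lead_ideal (I n) k" for k n
  have id: "ideal_in B (L k n)" for k n
    unfolding L_def using ideal_in_lead_ideal[OF B(1)] I by blast
  have incI: "I i \<subseteq> I j" if "i \<le> j" for i j
    using inc that lift_Suc_mono_le[of I] by blast
  have incn: "L k i \<subseteq> L k j" if "i \<le> j" for k i j
    unfolding L_def using lead_ideal_mono incI that by blast
  have "L i n \<subseteq> L j n" if "i \<le> j" for n i j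
    using lift_Suc_mono_le[of "\<lambda>i. L i n" i j] lead_ideal_Suc[OF B(1)] I that unfolding L_def by blast
  then have inc2: "L i n \<subseteq> L j n'" if "i \<le> j" "n \<le> n'" for n i j n'
    using incn that by (meson order_trans)
  have diag: "\<exists>N. \<forall>n\<ge>N. L n n = L N N"
    using B(2)[unfolded noetherian_in_def, rule_format, of "\<lambda>n. L n n"] id inc2 by simp
  then obtain M where M: "\<And>n. n \<ge> M \<Longrightarrow> L n n = L M M" by blast
  have "\<exists>N. \<forall>n\<ge>N. L k n = L k N" for k
    using B(2)[unfolded noetherian_in_def, rule_format, of "\<lambda>n. L k n"] id inc2 by simp
  then obtain N where N: "\<forall>k<M. \<forall>n\<ge>N. L k n = L k N"
    using stationary_max[of L M] by blast
  have "L k n \<subseteq> L k (max M N)" if n: "n \<ge> max M N" for k n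
  proof (cases "k < M")
    case True
    show ?thesis
      using N[rule_format, OF True, of n] N[rule_format, OF True, of "max M N"] n by simp
  next
    case False
    have "L k n \<subseteq> L (max k n) (max k n)" by (rule inc2) auto
    also have "\<dots> = L M M" using M[of "max k n"] False by simp
    also have "\<dots> \<subseteq> L k (max M N)" using False by (intro inc2) auto
    finally show ?thesis .
  qed
  note L_sub = this
  have "I n = I (max M N)" if n: "n \<ge> max M N" for n
  proof (rule ideal_eq_if_lead_ideals_eq[OF B(1)])
    show "lead_ideal (I n) k \<subseteq> lead_ideal (I (max M N)) k" for k
      using L_sub[OF n] unfolding L_def .
  qed (use I incI[OF n] in blast)+
  then show "\<exists>N. \<forall>n\<ge>N. I n = I N" by blast
qed

section \<open>Simple extensions \<open>B[x]\<close> inside the ambient ring\<close>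

definition ring_ext :: "'a::comm_ring_1 set \<Rightarrow> 'a \<Rightarrow> 'a set" where
  "ring_ext B x = (\<lambda>q. poly q x) ` polys_over B"

lemma ring_ext_superset: "0 \<in> B \<Longrightarrow> B \<subseteq> ring_ext B x"
proof
  fix b assume "0 \<in> B" "b \<in> B"
  then show "b \<in> ring_ext B x" unfolding ring_ext_def
    by (intro image_eqI[of _ _ "[:b:]"]) (auto simp: polys_over_def coeff_pCons split: nat.split)
qed

lemma is_subring_ring_ext:
  assumes "is_subring B"
  shows "is_subring (ring_ext B x)"
proof -
  note P = is_subringD[OF is_subring_polys_over[OF assms]]
  have "0 \<in> ring_ext B x" "1 \<in> ring_ext B x"
    unfolding ring_ext_def using P(1,2) by (force intro: image_eqI[of _ _ 0] image_eqI[of _ _ 1])+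
  moreover have "- poly p x \<in> ring_ext B x" if "p \<in> polys_over B" for p
    unfolding ring_ext_def using P(3)[OF that] by (intro image_eqI[of _ _ "- p"]) auto
  moreover have "poly p x + poly q x \<in> ring_ext B x" "poly p x * poly q x \<in> ring_ext B x"
    if "p \<in> polys_over B" "q \<in> polys_over B" for p q
    unfolding ring_ext_def using P(4,5)[OF that]
    by (auto intro: image_eqI[of _ _ "p + q"] image_eqI[of _ _ "p * q"])
  ultimately show ?thesis unfolding is_subring_def ring_ext_def by auto
qed

lemma ideal_in_ring_ext_vimage:
  assumes "is_subring B" "ideal_in (ring_ext B x) I"
  shows "ideal_in (polys_over B) {q \<in> polys_over B. poly q x \<in> I}"
  unfolding ideal_in_def
  using is_subringD[OF is_subring_polys_over[OF assms(1)]] ideal_inD[OF assms(2)]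
  by (auto simp: ring_ext_def)

text \<open>Evaluation at \<open>x\<close> maps the polynomials over \<open>B\<close> onto
  \<open>B[x]\<close>, whether or not \<open>x\<close> is algebraic over \<open>B\<close>, and an
  ideal is recovered from its preimage.\<close>

lemma noetherian_in_ring_ext:
  assumes B: "is_subring B" "noetherian_in B"
  shows "noetherian_in (ring_ext B x)"
  unfolding noetherian_in_def
proof (intro allI impI)
  fix I assume I: "\<forall>n. ideal_in (ring_ext B x) (I n)" and inc: "\<forall>n::nat. I n \<subseteq> I (Suc n)"
  define J where "J n = {q \<in> polys_over B. poly q x \<in> I n}" for n
  have "\<exists>N. \<forall>n\<ge>N. J n = J N"
    using hilbert_basis[OF B, unfolded noetherian_in_def, rule_format, of J]
      ideal_in_ring_ext_vimage[OF B(1)] I inc unfolding J_def by blast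
  moreover have "I n = (\<lambda>q. poly q x) ` J n" for n
    using ideal_inD(1)[OF I[rule_format]] unfolding J_def ring_ext_def by force
  ultimately show "\<exists>N. \<forall>n\<ge>N. I n = I N" by metis
qed

lemma ring_ext_self:
  assumes "is_subring B"
  shows "x \<in> ring_ext B x"
  unfolding ring_ext_def using is_subringD(1,2)[OF assms]
  by (intro image_eqI[of _ _ "monom 1 1"]) (auto simp: poly_monom monom_polys_over)

lemma poly_in_ideal:
  assumes "is_subring B" "ideal_in (ring_ext B x) Q" "p \<subseteq> Q" "q \<in> polys_over p"
  shows "poly q x \<in> Q"
proof -
  have "x ^ k \<in> ring_ext B x" for k
    using is_subringD(7)[OF is_subring_ring_ext[OF assms(1)]] ring_ext_self[OF assms(1)] by blast
  then show ?thesis unfolding poly_altdef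
    using assms(3,4) by (intro ideal_in_sum[OF assms(2)] ideal_inD(6)[OF assms(2)]) (auto simp: polys_over_def)
qed

section \<open>The theorem of Eisenbud, Evans and Storch\<close>

text \<open>Choose \<open>g\<close> of least degree in \<open>x\<close> among the elements of \<open>I\<close> that do not vanish modulo \<open>p\<close>. Where
  its leading coefficient \<open>l\<close> is invertible, division by \<open>g\<close> shows that \<open>g\<close> generates \<open>I\<close>.\<close>

lemma ideal_generated_off_locus:
  assumes B: "is_subring B" and p: "prime_in B p" and I: "ideal_in (ring_ext B x) I"
  shows "\<exists>g\<in>I. \<exists>l\<in>B. l \<notin> p \<and>
    (\<forall>Q. prime_in (ring_ext B x) Q \<longrightarrow> p \<subseteq> Q \<longrightarrow> g \<in> Q \<longrightarrow> l \<notin> Q \<longrightarrow> I \<subseteq> Q)"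
proof -
  note PO = is_subring_polys_over[OF B] and E = is_subring_ring_ext[OF B, of x]
  note idp = prime_inD(1)[OF p]
  have idP: "ideal_in (polys_over B) (polys_over p)"
    using ideal_in_polys_over[OF idp] .
  \<comment> \<open>The polynomials whose reduction modulo \<open>p\<close> comes from
    \<open>I\<close>, without forming the quotient: the value of \<open>q\<close> lies in
    \<open>I\<close> after a correction by a polynomial \<open>r\<close> over
    \<open>p\<close>.\<close>
  define J where "J = {q \<in> polys_over B. \<exists>r\<in>polys_over p. poly q x + poly r x \<in> I}"
  have J_sub: "J \<subseteq> polys_over B" unfolding J_def by auto
  have J: "q1 + q2 \<in> J" if q: "q1 \<in> J" "q2 \<in> J" for q1 q2
  proof -
    obtain r1 r2 where r: "r1 \<in> polys_over p" "poly q1 x + poly r1 x \<in> I"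
      "r2 \<in> polys_over p" "poly q2 x + poly r2 x \<in> I"
      using q unfolding J_def by auto
    have "poly (q1 + q2) x + poly (r1 + r2) x = (poly q1 x + poly r1 x) + (poly q2 x + poly r2 x)"
      by (simp add: algebra_simps)
    also have "\<dots> \<in> I" using ideal_inD(4)[OF I] r by blast
    finally show ?thesis unfolding J_def
      using is_subringD(4)[OF PO] ideal_inD(4)[OF idP r(1,3)] q J_sub by blast
  qed
  have J_mult: "a * q \<in> J" if aq: "a \<in> polys_over B" "q \<in> J" for a q
  proof -
    obtain r where r: "r \<in> polys_over p" "poly q x + poly r x \<in> I"
      using aq(2) unfolding J_def by blast
    have "poly (a * q) x + poly (a * r) x = poly a x * (poly q x + poly r x)"
      by (simp add: algebra_simps)
    also have "\<dots> \<in> I" using ideal_inD(5)[OF I _ r(2)] that(1) by (auto simp: ring_ext_def)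
    finally show ?thesis unfolding J_def
      using is_subringD(5)[OF PO that(1)] ideal_inD(5)[OF idP that(1) r(1)] that J_sub by blast
  qed
  have P_J: "q \<in> J" if "q \<in> polys_over p" for q
    using that ideal_inD(2)[OF idP that] ideal_inD(3)[OF I]
      ideal_in_uminus[OF PO idP that] unfolding J_def by (auto intro!: bexI[of _ "- q"])
  have J_diff: "q1 - q2 \<in> J" if "q1 \<in> J" "q2 \<in> J" for q1 q2
    using J[OF that(1) J_mult[of "- 1" q2]] that is_subringD(3)[OF PO is_subringD(2)[OF PO]] by simp
  have I_sub: "I \<subseteq> Q" if Q: "prime_in (ring_ext B x) Q" "\<And>q. q \<in> J \<Longrightarrow> poly q x \<in> Q" for Q
  proof
    fix i assume i: "i \<in> I"
    then obtain q where q: "q \<in> polys_over B" "i = poly q x"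
      using ideal_inD(1)[OF I] unfolding ring_ext_def by auto
    then have "q \<in> J" using i ideal_inD(3)[OF idP] unfolding J_def by (auto intro!: bexI[of _ 0])
    then show "i \<in> Q" using Q(2) q by simp
  qed
  show ?thesis
  proof (cases "J \<subseteq> polys_over p")
    \<comment> \<open>Here \<open>I\<close> lies in every prime over \<open>p\<close>, so
      \<open>g = 0\<close> and \<open>l = 1\<close> serve.\<close>
    case True
    have "I \<subseteq> Q" if "prime_in (ring_ext B x) Q" "p \<subseteq> Q" for Q
      using I_sub[OF that(1)] poly_in_ideal[OF B prime_inD(1)[OF that(1)] that(2)] True by blast
    then show ?thesis
      using ideal_inD(3)[OF I] is_subringD(2)[OF B] prime_inD(2)[OF p] by blast
  next
    case False
    then obtain d where d: "\<exists>g. g \<in> J \<and> g \<notin> polys_over p \<and> degree g = d"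
      and min: "\<And>e. e < d \<Longrightarrow> \<not> (\<exists>g. g \<in> J \<and> g \<notin> polys_over p \<and> degree g = e)"
      using exists_least_iff[of "\<lambda>d. \<exists>g. g \<in> J \<and> g \<notin> polys_over p \<and> degree g = d"] by blast
    from d obtain g where g: "g \<in> J" "g \<notin> polys_over p" "degree g = d" by blast
    define l where "l = coeff g d"
    have lB: "l \<in> B" using g(1) J_sub unfolding l_def polys_over_def by auto
    \<comment> \<open>Otherwise dropping the leading term changes \<open>g\<close> only by an
      element of \<open>polys_over p\<close> and lowers its degree, against minimality.\<close>
    have lp: "l \<notin> p"
    proof
      assume "l \<in> p"
      then have m: "monom l d \<in> polys_over p"
        using ideal_inD(3)[OF idp] by (simp add: monom_polys_over)
      then have gm: "g - monom l d \<in> J" using J_diff[OF g(1) P_J] by simp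
      have np: "g - monom l d \<notin> polys_over p"
        using g(2) ideal_inD(4)[OF idP _ m, of "g - monom l d"] by auto
      have "g - monom l d \<noteq> 0" using np ideal_inD(3)[OF idP] by auto
      then have "degree (g - monom l d) \<noteq> d"
        using leading_coeff_0_iff[of "g - monom l d"] by (auto simp: l_def)
      moreover have "degree (g - monom l d) \<le> d"
        using g(3) degree_monom_le by (intro degree_diff_le) auto
      ultimately show False using min[of "degree (g - monom l d)"] gm np by auto
    qed
    obtain r where r: "r \<in> polys_over p" "poly g x + poly r x \<in> I"
      using g(1) unfolding J_def by auto
    have "I \<subseteq> Q" if Q: "prime_in (ring_ext B x) Q" "p \<subseteq> Q" "poly g x + poly r x \<in> Q" "l \<notin> Q" for Q
    proof (rule I_sub[OF Q(1)])
      note idQ = prime_inD(1)[OF Q(1)]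
      have PQ: "poly q x \<in> Q" if "q \<in> polys_over p" for q
        using poly_in_ideal[OF B idQ Q(2) that] .
      have gQ: "poly g x \<in> Q"
        using Q(3) ideal_in_add_cancel[OF E idQ PQ[OF r(1)]] by simp
      fix q assume "q \<in> J"
      then show "poly q x \<in> Q"
      proof (induction "degree q" arbitrary: q rule: less_induct)
        case less
        show ?case
        proof (cases "degree q < d \<or> q \<in> polys_over p")
          case True
          then show ?thesis using min less.prems PQ by blast
        next
          case False
          then have dq: "d \<le> degree q" "q \<noteq> 0" using ideal_inD(3)[OF idP] by auto
          \<comment> \<open>Pseudo-division: \<open>l * q\<close> minus a multiple of
            \<open>g\<close> stays in \<open>J\<close> and is zero or of smaller degree than
            \<open>q\<close>. The factor \<open>l\<close> is removed at the end, since
            \<open>Q\<close> is prime and misses it.\<close>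
          define c where "c = lead_coeff q"
          define q' where "q' = [:l:] * q - monom c (degree q - d) * g"
          have cB: "c \<in> B" using less.prems J_sub unfolding c_def polys_over_def by auto
          have "[:l:] \<in> polys_over B"
            using lB is_subringD(1)[OF B] by (auto simp: polys_over_def coeff_pCons split: nat.split)
          then have q'J: "q' \<in> J" unfolding q'_def
            using J_diff[OF J_mult J_mult] less.prems g(1) monom_polys_over[OF cB is_subringD(1)[OF B]]
            by blast
          have xk: "poly (monom c (degree q - d)) x \<in> ring_ext B x"
            using monom_polys_over[OF cB is_subringD(1)[OF B]] unfolding ring_ext_def by blast
          have "poly q' x \<in> Q"
          proof (cases "q' = 0")
            case False
            have "degree q' \<le> degree q" unfolding q'_def
              using dq g(3) degree_smult_le[of l q] degree_mult_le[of "monom c (degree q - d)" g]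
                degree_monom_le[of c "degree q - d"]
              by (intro degree_diff_le) auto
            moreover have "coeff q' (degree q) = 0"
              using dq by (simp add: q'_def coeff_monom_mult l_def c_def)
            ultimately have "degree q' < degree q"
              using False leading_coeff_0_iff[of q'] by (metis le_neq_implies_less)
            then show ?thesis using less.hyps q'J by blast
          qed (use ideal_inD(3)[OF idQ] in simp)
          moreover have "poly (monom c (degree q - d)) x * poly g x \<in> Q"
            using ideal_inD(5)[OF idQ xk gQ] .
          ultimately have "poly q' x + poly (monom c (degree q - d)) x * poly g x \<in> Q"
            using ideal_inD(4)[OF idQ] by blast
          then have "l * poly q x \<in> Q" by (simp add: q'_def)
          moreover have "poly q x \<in> ring_ext B x"
            using less.prems J_sub unfolding ring_ext_def by auto
          ultimately show ?thesis
            using prime_inD(3)[OF Q(1), of l "poly q x"] Q(4) ring_ext_superset[OF is_subringD(1)[OF B], of x] lB by blast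
        qed
      qed
    qed
    then show ?thesis using r(2) lB lp by blast
  qed
qed

text \<open>Separates the members of a finite antichain of primes, so that generators found for each
  prime can be combined into a single one.\<close>

lemma prime_antichain_separator:
  assumes A: "is_subring A" and F: "finite F" "\<And>q. q \<in> F \<Longrightarrow> prime_in A q" and p: "prime_in A p"
    and anti: "\<And>q. q \<in> F \<Longrightarrow> \<not> q \<subseteq> p"
  shows "\<exists>e\<in>A. e \<notin> p \<and> (\<forall>q\<in>F. e \<in> q)"
  using F anti
proof (induction F rule: finite_induct)
  case empty
  then show ?case using is_subringD(2)[OF A] prime_inD(2)[OF p] by auto
next
  case (insert q F)
  then obtain e where e: "e \<in> A" "e \<notin> p" "\<forall>q\<in>F. e \<in> q" by auto
  obtain a where a: "a \<in> q" "a \<notin> p" using insert.prems(2) by blast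
  have aA: "a \<in> A" using ideal_inD(2)[OF prime_inD(1)[OF insert.prems(1)] a(1)] by simp
  have "a * e \<in> A" "a * e \<notin> p" using aA e a prime_inD(3)[OF p aA e(1)] is_subringD(5)[OF A] by auto
  moreover have "a * e \<in> q'" if "q' \<in> insert q F" for q'
    using that ideal_inD(5,6)[OF prime_inD(1)[OF insert.prems(1)[OF that]]] a(1) e(1,3) aA by auto
  ultimately show ?case by blast
qed

text \<open>One element \<open>G\<close> takes care of all \<open>Q\<close> except those containing \<open>p + (t p)\<close> for some \<open>p \<in> F\<close>,
  where \<open>t p \<notin> p\<close>; the minimal primes of \<open>p + (t p)\<close> have smaller rank.\<close>

theorem eisenbud_evans_storch:
  fixes rk :: "'a::comm_ring_1 set \<Rightarrow> nat"
  assumes B: "is_subring B" "noetherian_in B" and I: "ideal_in (ring_ext B x) I"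
    and rk: "\<And>p q. prime_in B p \<Longrightarrow> prime_in B q \<Longrightarrow> p \<subset> q \<Longrightarrow> rk q < rk p"
    and F: "finite F" "\<And>p. p \<in> F \<Longrightarrow> prime_in B p \<and> rk p < d"
  shows "\<exists>f. (\<forall>i\<in>{1..d}. f i \<in> I) \<and>
    (\<forall>Q. prime_in (ring_ext B x) Q \<longrightarrow> (\<exists>p\<in>F. p \<subseteq> Q) \<longrightarrow> (\<forall>i\<in>{1..d}. f i \<in> Q) \<longrightarrow> I \<subseteq> Q)"
  using F
proof (induction d arbitrary: F)
  case 0
  then have "F = {}" by auto
  then show ?case by auto
next
  case (Suc d)
  let ?A = "ring_ext B x"
  note AS = is_subring_ring_ext[OF B(1), of x]
  have BA: "B \<subseteq> ?A" using ring_ext_superset is_subringD(1)[OF B(1)] by blast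
  \<comment> \<open>Separators exist for antichains, so \<open>F\<close> is thinned to its minimal
    members; every prime over a member of \<open>F\<close> is also over a minimal one.\<close>
  define F0 where "F0 = {p\<in>F. \<forall>q\<in>F. q \<subseteq> p \<longrightarrow> q = p}"
  have F0: "finite F0" "\<And>p. p \<in> F0 \<Longrightarrow> prime_in B p \<and> rk p < Suc d" "\<And>p q. p \<in> F0 \<Longrightarrow> q \<in> F0 \<Longrightarrow> q \<subseteq> p \<Longrightarrow> q = p"
    using Suc.prems unfolding F0_def by auto
  have F0_min: "\<exists>q\<in>F0. q \<subseteq> p" if pF: "p \<in> F" for p
  proof -
    obtain q where "q \<in> F" "q \<subseteq> p" "\<forall>r\<in>F. r \<subseteq> q \<longrightarrow> q = r"
      using finite_has_minimal2[OF Suc.prems(1) pF] by blast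
    then show ?thesis unfolding F0_def by blast
  qed
  have "\<forall>p\<in>F0. \<exists>g l. g \<in> I \<and> l \<in> B \<and> l \<notin> p \<and>
    (\<forall>Q. prime_in ?A Q \<longrightarrow> p \<subseteq> Q \<longrightarrow> g \<in> Q \<longrightarrow> l \<notin> Q \<longrightarrow> I \<subseteq> Q)"
    using ideal_generated_off_locus[OF B(1) _ I] F0(2) by blast
  then obtain g l where gl: "\<And>p. p \<in> F0 \<Longrightarrow> g p \<in> I \<and> l p \<in> B \<and> l p \<notin> p"
    "\<And>p Q. p \<in> F0 \<Longrightarrow> prime_in ?A Q \<Longrightarrow> p \<subseteq> Q \<Longrightarrow> g p \<in> Q \<Longrightarrow> l p \<notin> Q \<Longrightarrow> I \<subseteq> Q"
    unfolding bchoice_iff by metis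
  have "\<forall>p\<in>F0. \<exists>e. e \<in> B \<and> e \<notin> p \<and> (\<forall>q\<in>F0 - {p}. e \<in> q)"
  proof
    fix p assume "p \<in> F0"
    then show "\<exists>e. e \<in> B \<and> e \<notin> p \<and> (\<forall>q\<in>F0 - {p}. e \<in> q)"
      using prime_antichain_separator[OF B(1), of "F0 - {p}" p] F0 by blast
  qed
  then obtain e where e: "\<And>p. p \<in> F0 \<Longrightarrow> e p \<in> B \<and> e p \<notin> p"
    "\<And>p q. p \<in> F0 \<Longrightarrow> q \<in> F0 \<Longrightarrow> p \<noteq> q \<Longrightarrow> e p \<in> q"
    unfolding bchoice_iff by (metis Diff_iff singletonD)
  \<comment> \<open>Modulo a prime over \<open>p\<close> all other terms vanish, because
    \<open>e q\<close> lies in \<open>p\<close> for \<open>q\<close> different from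
    \<open>p\<close>. A prime that also misses \<open>t p\<close> misses \<open>e p\<close>, which
    can then be cancelled, and \<open>l p\<close>, as the choice of \<open>g p\<close>
    requires.\<close>
  define G where "G = (\<Sum>p\<in>F0. e p * g p)"
  define t where "t p = e p * l p" for p
  have G: "G \<in> I" unfolding G_def
    using e(1) gl(1) BA by (intro ideal_in_sum[OF I] ideal_inD(5)[OF I]) auto
  have t: "t p \<in> B" "t p \<notin> p" if "p \<in> F0" for p
    using e(1)[OF that] gl(1)[OF that] prime_inD(3)[of B p "e p" "l p"] F0(2)[OF that]
      is_subringD(5)[OF B(1)] unfolding t_def by auto
  have G_step: "I \<subseteq> Q" if p: "p \<in> F0" and Q: "prime_in ?A Q" "p \<subseteq> Q" "G \<in> Q" "t p \<notin> Q" for p Q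
  proof -
    note idQ = prime_inD(1)[OF Q(1)]
    have gA: "g q \<in> ?A" if "q \<in> F0" for q using gl(1)[OF that] ideal_inD(2)[OF I] by auto
    have "(\<Sum>q\<in>F0-{p}. e q * g q) \<in> Q"
      using e(2)[OF _ p] Q(2) gA by (intro ideal_in_sum[OF idQ] ideal_inD(6)[OF idQ]) auto
    moreover have "G = e p * g p + (\<Sum>q\<in>F0-{p}. e q * g q)"
      unfolding G_def using F0(1) p by (simp add: sum.remove)
    ultimately have "e p * g p \<in> Q"
      using Q(3) ideal_in_add_cancel[OF AS idQ] by metis
    moreover have "e p \<notin> Q"
      using Q(4) ideal_inD(6)[OF idQ, of "l p" "e p"] gl(1)[OF p] BA unfolding t_def by auto
    ultimately have "g p \<in> Q" using prime_inD(3)[OF Q(1) _ gA[OF p]] e(1)[OF p] BA by blast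
    moreover have "l p \<notin> Q"
      using Q(4) ideal_inD(5)[OF idQ, of "e p" "l p"] e(1)[OF p] BA unfolding t_def by auto
    ultimately show ?thesis using gl(2)[OF p Q(1,2)] by blast
  qed
  have "\<forall>p\<in>F0. \<exists>M. finite M \<and> (\<forall>q\<in>M. prime_in B q \<and> adjoin B p (t p) \<subseteq> q) \<and>
      (\<forall>Q. prime_in B Q \<longrightarrow> adjoin B p (t p) \<subseteq> Q \<longrightarrow> (\<exists>q\<in>M. q \<subseteq> Q))"
  proof
    fix p assume "p \<in> F0"
    then have "ideal_in B (adjoin B p (t p))"
      using ideal_in_adjoin[OF B(1)] F0(2) t(1) prime_inD(1) by blast
    from finitely_many_minimal_primes[OF B this] show "\<exists>M. finite M \<and> (\<forall>q\<in>M. prime_in B q \<and> adjoin B p (t p) \<subseteq> q) \<and>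
      (\<forall>Q. prime_in B Q \<longrightarrow> adjoin B p (t p) \<subseteq> Q \<longrightarrow> (\<exists>q\<in>M. q \<subseteq> Q))" by metis
  qed
  then obtain M where M: "\<And>p. p \<in> F0 \<Longrightarrow> finite (M p)"
    "\<And>p q. p \<in> F0 \<Longrightarrow> q \<in> M p \<Longrightarrow> prime_in B q \<and> adjoin B p (t p) \<subseteq> q"
    "\<And>p Q. p \<in> F0 \<Longrightarrow> prime_in B Q \<Longrightarrow> adjoin B p (t p) \<subseteq> Q \<Longrightarrow> \<exists>q\<in>M p. q \<subseteq> Q"
    unfolding bchoice_iff by metis
  \<comment> \<open>\<open>t p\<close> lies in \<open>q\<close> but not in \<open>p\<close>, so the
    rank drops below \<open>d\<close>. The induction hypothesis supplies \<open>d\<close> elements,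
    and \<open>G\<close> is the element number \<open>Suc d\<close>.\<close>
  have M_rk: "prime_in B q \<and> rk q < d" if qM: "q \<in> (\<Union>p\<in>F0. M p)" for q
  proof -
    obtain p where p: "p \<in> F0" "q \<in> M p" using qM by auto
    have "p \<subset> q"
      using M(2)[OF p] adjoin_superset[OF B(1) prime_inD(1), of p "t p"] F0(2)[OF p(1)] t(2)[OF p(1)] by blast
    then show ?thesis using rk[of p q] M(2)[OF p] F0(2)[OF p(1)] by fastforce
  qed
  obtain f where f: "\<forall>i\<in>{1..d}. f i \<in> I"
    "\<And>Q. prime_in ?A Q \<Longrightarrow> \<exists>p\<in>(\<Union>p\<in>F0. M p). p \<subseteq> Q \<Longrightarrow> (\<forall>i\<in>{1..d}. f i \<in> Q) \<Longrightarrow> I \<subseteq> Q"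
    using Suc.IH[of "\<Union>p\<in>F0. M p"] M(1) F0(1) M_rk by auto
  show ?case
  proof (intro exI[of _ "f(Suc d := G)"] conjI allI impI)
    show "\<forall>i\<in>{1..Suc d}. (f(Suc d := G)) i \<in> I" using f(1) G by auto
    fix Q assume Q: "prime_in ?A Q" "\<exists>p\<in>F. p \<subseteq> Q" "\<forall>i\<in>{1..Suc d}. (f(Suc d := G)) i \<in> Q"
    have fQ: "\<forall>i\<in>{1..d}. f i \<in> Q" "G \<in> Q"
      using Q(3) by (fastforce dest: bspec, force)
    obtain p where p: "p \<in> F0" "p \<subseteq> Q" using Q(2) F0_min by blast
    show "I \<subseteq> Q"
    proof (cases "t p \<in> Q")
      case True
      \<comment> \<open>The ranked primes live in \<open>B\<close>, so \<open>Q\<close> is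
        contracted to \<open>B\<close> before a member of \<open>M p\<close> is found below
        it.\<close>
      note QB = prime_in_Int_subring[OF Q(1) B(1) BA]
      have "adjoin B p (t p) \<subseteq> Q \<inter> B"
        using adjoin_least[OF prime_inD(1)[OF QB], of p "t p"] p True t(1)[OF p(1)]
          ideal_inD(1)[OF prime_inD(1), of B p] F0(2)[OF p(1)] by blast
      then obtain q where "q \<in> M p" "q \<subseteq> Q \<inter> B" using M(3)[OF p(1) QB] by blast
      then show ?thesis using f(2)[OF Q(1) _ fQ(1)] p(1) by blast
    next
      case False
      then show ?thesis using G_step[OF p(1) Q(1) p(2) fQ(2)] by simp
    qed
  qed
qed

section \<open>Polynomials in several variables\<close>

text \<open>The carrier of \<open>mpoly_ring n\<close> as a bare set, so that the type class
  arithmetic of the ambient polynomials applies.\<close>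

definition mpolys :: "nat \<Rightarrow> ('k::comm_ring_1) mpoly set" where
  "mpolys n = {p. \<forall>u\<in>Poly_Mapping.keys p. Poly_Mapping.keys u \<subseteq> {1..n}}"

definition mconst :: "'k::comm_ring_1 \<Rightarrow> 'k mpoly" where
  "mconst c = Poly_Mapping.single 0 c"

definition mvar :: "nat \<Rightarrow> ('k::comm_ring_1) mpoly" where
  "mvar i = Poly_Mapping.single (Poly_Mapping.single i 1) 1"

definition meval_mon :: "(nat \<Rightarrow> ('k::comm_ring_1) mpoly) \<Rightarrow> (nat \<Rightarrow>\<^sub>0 nat) \<Rightarrow> 'k mpoly" where
  "meval_mon f u = (\<Prod>i\<in>Poly_Mapping.keys u. f i ^ Poly_Mapping.lookup u i)"

text \<open>One substitution map serves for polynomial expressions in \<open>f 1, ..., f d\<close>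
  and, with constants as values, for evaluation at a point.\<close>

definition meval :: "(nat \<Rightarrow> ('k::comm_ring_1) mpoly) \<Rightarrow> 'k mpoly \<Rightarrow> 'k mpoly" where
  "meval f p = (\<Sum>u\<in>Poly_Mapping.keys p. mconst (Poly_Mapping.lookup p u) * meval_mon f u)"

lemma mconst_simps [simp]:
  "mconst 0 = 0" "mconst 1 = 1" "mconst (a + b) = mconst a + mconst b" "mconst (a * b) = mconst a * mconst b"
  "mconst (a - b) = mconst a - mconst b" "mconst a = mconst b \<longleftrightarrow> a = b"
  by (auto simp: mconst_def single_add mult_single single_diff dest: injD[OF inj_single])

lemma mconst_eq_0_iff [simp]: "mconst a = 0 \<longleftrightarrow> a = 0"
  using mconst_simps(6)[of a 0] by (simp del: mconst_simps(6))

lemma mconst_inverse_mult: "a \<noteq> 0 \<Longrightarrow> mconst (inverse a) * mconst a = 1" for a :: "'k::field"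
  unfolding mconst_simps(4)[symmetric] by simp

lemma lookup_mconst_mult: "Poly_Mapping.lookup (mconst c * p) u = c * Poly_Mapping.lookup p u"
  unfolding mconst_def mult_map_scale_conv_mult[symmetric] by (simp add: map.rep_eq when_def)

lemma is_subring_mpolys: "is_subring (mpolys n)"
  unfolding is_subring_def mpolys_def
proof (intro conjI ballI CollectI)
  fix x y :: "'a mpoly" and u
  assume x: "x \<in> {p. \<forall>u\<in>Poly_Mapping.keys p. Poly_Mapping.keys u \<subseteq> {1..n}}"
  show "Poly_Mapping.keys u \<subseteq> {1..n}" if "u \<in> Poly_Mapping.keys (- x)"
    using x that by (auto simp: in_keys_iff)
  assume y: "y \<in> {p. \<forall>u\<in>Poly_Mapping.keys p. Poly_Mapping.keys u \<subseteq> {1..n}}"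
  show "Poly_Mapping.keys u \<subseteq> {1..n}" if "u \<in> Poly_Mapping.keys (x + y)"
    using x y that Poly_Mapping.keys_add[of x y] by auto
  show "Poly_Mapping.keys u \<subseteq> {1..n}" if u: "u \<in> Poly_Mapping.keys (x * y)"
  proof -
    obtain v w where "v \<in> Poly_Mapping.keys x" "w \<in> Poly_Mapping.keys y" "u = v + w"
      using u Poly_Mapping.keys_mult[of x y] by auto
    then show ?thesis using x y Poly_Mapping.keys_add[of v w] by fastforce
  qed
qed auto

lemma mconst_in_mpolys [simp]: "mconst c \<in> mpolys n"
  by (auto simp: mconst_def mpolys_def)

lemma mvar_in_mpolys: "i \<in> {1..n} \<Longrightarrow> mvar i \<in> mpolys n"
  by (auto simp: mvar_def mpolys_def)

lemma mpolys_mono: "m \<le> n \<Longrightarrow> mpolys m \<subseteq> mpolys n"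
  unfolding mpolys_def by fastforce

lemma poly_mapping_sum_singles:
  "(\<Sum>k\<in>Poly_Mapping.keys p. Poly_Mapping.single k (Poly_Mapping.lookup p k)) = p"
proof (rule poly_mapping_eqI)
  fix k
  have "Poly_Mapping.lookup (\<Sum>k\<in>Poly_Mapping.keys p. Poly_Mapping.single k (Poly_Mapping.lookup p k)) k =
    (\<Sum>j\<in>Poly_Mapping.keys p. if j = k then Poly_Mapping.lookup p j else 0)"
    unfolding lookup_sum by (intro sum.cong) (auto simp: lookup_single)
  also have "\<dots> = Poly_Mapping.lookup p k"
    by (simp add: sum.delta in_keys_iff)
  finally show "Poly_Mapping.lookup (\<Sum>k\<in>Poly_Mapping.keys p. Poly_Mapping.single k (Poly_Mapping.lookup p k)) k =
    Poly_Mapping.lookup p k" .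
qed

lemma mvar_power: "mvar i ^ k = Poly_Mapping.single (Poly_Mapping.single i k) 1"
  by (induction k) (simp_all add: mvar_def mult_single single_add[symmetric])

lemma single_eq_mconst_mult: "Poly_Mapping.single u c = mconst c * meval_mon mvar u"
proof -
  have "(\<Prod>i\<in>X. mvar i ^ g i) = Poly_Mapping.single (\<Sum>i\<in>X. Poly_Mapping.single i (g i)) (1::'a)"
    if "finite X" for X g
    using that by (induction X rule: finite_induct) (simp_all add: mvar_power mult_single)
  then have "meval_mon mvar u = Poly_Mapping.single u (1::'a)"
    unfolding meval_mon_def by (simp add: poly_mapping_sum_singles)
  then show ?thesis by (simp add: mconst_def mult_single)
qed

lemma meval_mon_superset:
  assumes "finite X" "Poly_Mapping.keys u \<subseteq> X"
  shows "meval_mon f u = (\<Prod>i\<in>X. f i ^ Poly_Mapping.lookup u i)"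
  unfolding meval_mon_def
  using assms by (intro prod.mono_neutral_left) (auto simp: in_keys_iff)

lemma meval_mon_add: "meval_mon f (u + v) = meval_mon f u * meval_mon f v"
proof -
  let ?X = "Poly_Mapping.keys u \<union> Poly_Mapping.keys v"
  have "meval_mon f w = (\<Prod>i\<in>?X. f i ^ Poly_Mapping.lookup w i)" if "w \<in> {u, v, u + v}" for w
    using that Poly_Mapping.keys_add[of u v] by (intro meval_mon_superset) auto
  then show ?thesis by (simp add: lookup_add power_add prod.distrib)
qed

lemma meval_superset:
  assumes "finite X" "Poly_Mapping.keys p \<subseteq> X"
  shows "meval f p = (\<Sum>u\<in>X. mconst (Poly_Mapping.lookup p u) * meval_mon f u)"
  unfolding meval_def
  using assms by (intro sum.mono_neutral_left) (auto simp: in_keys_iff)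

lemma meval_single: "meval f (Poly_Mapping.single u c) = mconst c * meval_mon f u"
  by (subst meval_superset[of "{u}"]) auto

lemma meval_0 [simp]: "meval f 0 = 0"
  by (simp add: meval_def)

lemma meval_add [simp]: "meval f (p + q) = meval f p + meval f q"
proof -
  let ?X = "Poly_Mapping.keys p \<union> Poly_Mapping.keys q"
  have "meval f r = (\<Sum>u\<in>?X. mconst (Poly_Mapping.lookup r u) * meval_mon f u)" if "r \<in> {p, q, p + q}" for r
    using that Poly_Mapping.keys_add[of p q] by (intro meval_superset) auto
  then show ?thesis by (simp add: lookup_add sum.distrib distrib_right)
qed

lemma meval_sum: "meval f (sum g X) = (\<Sum>i\<in>X. meval f (g i))"
  by (induction X rule: infinite_finite_induct) auto

lemma meval_mult [simp]: "meval f (p * q) = meval f p * meval f q"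
proof -
  have "meval f (p * q) = meval f ((\<Sum>u\<in>Poly_Mapping.keys p. Poly_Mapping.single u (Poly_Mapping.lookup p u)) *
      (\<Sum>u\<in>Poly_Mapping.keys q. Poly_Mapping.single u (Poly_Mapping.lookup q u)))"
    by (simp only: poly_mapping_sum_singles)
  also have "\<dots> = meval f p * meval f q"
    unfolding sum_product meval_sum mult_single meval_single meval_mon_add
    unfolding meval_def sum_product by (intro sum.cong refl) (simp add: algebra_simps)
  finally show ?thesis .
qed

lemma meval_mconst [simp]: "meval f (mconst c) = mconst c"
  unfolding mconst_def meval_single by (simp add: meval_mon_def mconst_def)

lemma meval_1 [simp]: "meval f 1 = 1"
  using meval_mconst[of f 1] by simp

lemma meval_mvar [simp]: "meval f (mvar i) = f i"
  unfolding mvar_def meval_single by (simp add: meval_mon_def)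

lemma meval_uminus [simp]: "meval f (- p) = - meval f p"
  using meval_add[of f p "- p"] by (simp add: add_eq_0_iff del: meval_add)

lemma meval_diff [simp]: "meval f (p - q) = meval f p - meval f q"
  using meval_add[of f p "- q"] by (simp del: meval_add)

lemma meval_prod: "meval f (prod g X) = (\<Prod>i\<in>X. meval f (g i))"
  by (induction X rule: infinite_finite_induct) auto

text \<open>Constants and variables generate \<open>mpolys n\<close> as a ring. With this rule,
  facts about substitution can be proved without exponent vectors.\<close>

lemma mpolys_induct [consumes 1, case_names const var add mult]:
  assumes "p \<in> mpolys n" and "\<And>c. Q (mconst c)" and "\<And>i. i \<in> {1..n} \<Longrightarrow> Q (mvar i)"
    and "\<And>p q. Q p \<Longrightarrow> Q q \<Longrightarrow> Q (p + q)" and "\<And>p q. Q p \<Longrightarrow> Q q \<Longrightarrow> Q (p * q)"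
  shows "Q p"
proof -
  have 0: "Q 0" and 1: "Q 1" using assms(2)[of 0] assms(2)[of 1] by simp_all
  have pow: "Q (q ^ k)" if "Q q" for q k using that 1 assms(5) by (induction k) auto
  have prod: "Q (prod g X)" if "\<And>i. i \<in> X \<Longrightarrow> Q (g i)" for g and X :: "nat set"
    using that 1 assms(5) by (induction X rule: infinite_finite_induct) auto
  have sum: "Q (sum g X)" if "\<And>i. i \<in> X \<Longrightarrow> Q (g i)" for g and X :: "(nat \<Rightarrow>\<^sub>0 nat) set"
    using that 0 assms(4) by (induction X rule: infinite_finite_induct) auto
  have "Q (\<Sum>u\<in>Poly_Mapping.keys p. Poly_Mapping.single u (Poly_Mapping.lookup p u))"
  proof (rule sum)
    fix u assume "u \<in> Poly_Mapping.keys p"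
    then have "Poly_Mapping.keys u \<subseteq> {1..n}" using assms(1) unfolding mpolys_def by auto
    then show "Q (Poly_Mapping.single u (Poly_Mapping.lookup p u))"
      unfolding single_eq_mconst_mult meval_mon_def
      by (intro assms(5) assms(2) prod pow assms(3)) auto
  qed
  then show ?thesis by (simp add: poly_mapping_sum_singles)
qed

lemma meval_in_subring:
  assumes "p \<in> mpolys n" "is_subring A" "range mconst \<subseteq> A" "\<And>i. i \<in> {1..n} \<Longrightarrow> f i \<in> A"
  shows "meval f p \<in> A"
  using assms(1) by (induction p rule: mpolys_induct) (use assms(3,4) is_subringD[OF assms(2)] in auto)

lemma meval_in_mpolys:
  assumes "p \<in> mpolys n" "\<And>i. i \<in> {1..n} \<Longrightarrow> f i \<in> mpolys m"
  shows "meval f p \<in> mpolys m"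
  by (rule meval_in_subring[OF assms(1) is_subring_mpolys]) (use assms(2) in auto)

lemma meval_cong:
  assumes "p \<in> mpolys n" "\<And>i. i \<in> {1..n} \<Longrightarrow> f i = g i"
  shows "meval f p = meval g p"
  using assms(1) by (induction p rule: mpolys_induct) (use assms(2) in auto)

lemma meval_mvar_id:
  assumes "p \<in> mpolys n"
  shows "meval mvar p = p"
  using assms by (induction p rule: mpolys_induct) auto

lemma mpolys_0E:
  assumes "p \<in> mpolys 0"
  obtains c where "p = mconst c"
proof -
  have "\<exists>c. p = mconst c"
    using assms
  proof (induction p rule: mpolys_induct)
    case (add p q)
    then obtain a b where "p = mconst a" "q = mconst b" by blast
    then show ?case by (intro exI[of _ "a + b"]) simp
  next
    case (mult p q)
    then obtain a b where "p = mconst a" "q = mconst b" by blast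
    then show ?case by (intro exI[of _ "a * b"]) simp
  qed auto
  with that show thesis by blast
qed

text \<open>The bridge for inductions on the number of variables: results on \<open>ring_ext\<close>
  apply with the last variable as \<open>x\<close>.\<close>

lemma mpolys_Suc: "mpolys (Suc n) = ring_ext (mpolys n) (mvar (Suc n))"
proof
  note E = is_subringD[OF is_subring_ring_ext[OF is_subring_mpolys, of n "mvar (Suc n) :: 'a mpoly"]]
  have sub: "mpolys n \<subseteq> ring_ext (mpolys n) (mvar (Suc n) :: 'a mpoly)"
    by (rule ring_ext_superset) (rule is_subringD(1)[OF is_subring_mpolys])
  have X: "mvar (Suc n) \<in> ring_ext (mpolys n) (mvar (Suc n) :: 'a mpoly)"
    by (rule ring_ext_self[OF is_subring_mpolys])
  show "mpolys (Suc n) \<subseteq> ring_ext (mpolys n) (mvar (Suc n) :: 'a mpoly)"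
  proof
    fix p :: "'a mpoly" assume "p \<in> mpolys (Suc n)"
    then show "p \<in> ring_ext (mpolys n) (mvar (Suc n))"
    proof (induction p rule: mpolys_induct)
      case (var i)
      then show ?case using X sub mvar_in_mpolys[of i n] by (cases "i = Suc n") auto
    qed (use sub E mconst_in_mpolys in auto)
  qed
  show "ring_ext (mpolys n) (mvar (Suc n)) \<subseteq> (mpolys (Suc n) :: 'a mpoly set)"
  proof
    fix p :: "'a mpoly" assume "p \<in> ring_ext (mpolys n) (mvar (Suc n))"
    then obtain q where q: "\<And>k. coeff q k \<in> mpolys n" "p = poly q (mvar (Suc n))"
      unfolding ring_ext_def polys_over_def by auto
    have "coeff q k \<in> mpolys (Suc n)" for k using q(1) mpolys_mono[of n "Suc n"] by auto
    then show "p \<in> mpolys (Suc n)" unfolding q(2) poly_altdef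
      by (intro is_subring_sum[OF is_subring_mpolys] is_subringD(5,7)[OF is_subring_mpolys] mvar_in_mpolys) auto
  qed
qed

lemma noetherian_in_mpolys: "noetherian_in (mpolys n :: 'k::field mpoly set)"
proof (induction n)
  case 0
  show ?case unfolding noetherian_in_def
  proof (intro allI impI)
    fix I :: "nat \<Rightarrow> 'k mpoly set"
    assume I: "\<forall>n. ideal_in (mpolys 0) (I n)" and inc: "\<forall>n. I n \<subseteq> I (Suc n)"
    \<comment> \<open>A nonzero constant is a unit, so only two ideals are possible.\<close>
    have dich: "I n = mpolys 0" if nz: "I n \<noteq> {0}" for n
    proof -
      note id = ideal_inD[OF I[rule_format, of n]]
      obtain p where p: "p \<in> I n" "p \<noteq> 0" using nz id(3) by blast
      obtain c where c: "p = mconst c" using id(2)[OF p(1)] by (rule mpolys_0E)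
      have "mconst (inverse c) * p = 1" using p(2) c mconst_inverse_mult by auto
      then have "1 \<in> I n" using id(5)[OF _ p(1), of "mconst (inverse c)"] by simp
      then show ?thesis using id(1) id(6)[of _ 1] by auto
    qed
    show "\<exists>N. \<forall>n\<ge>N. I n = I N"
    proof (cases "\<exists>N. I N \<noteq> {0}")
      case True
      then obtain N where N: "I N \<noteq> {0}" by blast
      have "I n = I N" if "n \<ge> N" for n
      proof -
        have "I N \<subseteq> I n" using inc that lift_Suc_mono_le[of I] by blast
        then have "I n \<noteq> {0}" using N ideal_inD(3)[OF I[rule_format, of N]] by auto
        then show ?thesis using dich[of n] dich[OF N] by blast
      qed
      then show ?thesis by blast
    qed auto
  qed
next
  case (Suc n)
  then show ?case unfolding mpolys_Suc using noetherian_in_ring_ext[OF is_subring_mpolys] by blast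
qed

lemma pCons_in_polys_over_iff: "pCons a r \<in> polys_over B \<longleftrightarrow> a \<in> B \<and> r \<in> polys_over B"
proof
  assume *: "pCons a r \<in> polys_over B"
  have "coeff r k \<in> B" for k
    using *[unfolded polys_over_def mem_Collect_eq, rule_format, of "Suc k"] by simp
  moreover have "a \<in> B"
    using *[unfolded polys_over_def mem_Collect_eq, rule_format, of 0] by simp
  ultimately show "a \<in> B \<and> r \<in> polys_over B" by (simp add: polys_over_def)
qed (auto simp: polys_over_def coeff_pCons split: nat.split)

text \<open>The new variable is transcendental over the old ones: otherwise a nonzero univariate
  polynomial over an integral domain would vanish at all constants \<open>mconst c\<close>, of which
  characteristic 0 provides infinitely many.\<close>

lemma poly_mvar_eq_0D:
  fixes q :: "'k::field_char_0 mpoly poly"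
  assumes "q \<in> polys_over (mpolys n)" "poly q (mvar (Suc n)) = 0"
  shows "q = 0"
proof (rule ccontr)
  assume "q \<noteq> 0"
  have ev: "meval (mvar(Suc n := mconst c)) (poly r (mvar (Suc n))) = poly r (mconst c)"
    if "r \<in> polys_over (mpolys n)" for r :: "'k mpoly poly" and c
    using that
  proof (induction r)
    case (pCons a r)
    have a: "a \<in> mpolys n" and r: "r \<in> polys_over (mpolys n)"
      using pCons.prems by (simp_all add: pCons_in_polys_over_iff)
    have "meval (mvar(Suc n := mconst c)) a = meval mvar a"
      using a by (rule meval_cong) auto
    then show ?case using pCons.IH[OF r] meval_mvar_id[OF a] by (simp del: fun_upd_apply) simp
  qed simp
  have "poly q (mconst c) = 0" for c
    using ev[OF assms(1), of c] assms(2) by simp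
  then have "range mconst \<subseteq> {x. poly q x = 0}" by auto
  moreover have "infinite (range (mconst :: 'k \<Rightarrow> 'k mpoly))"
    using infinite_UNIV_char_0 by (auto dest!: finite_imageD simp: inj_on_def)
  ultimately show False using poly_roots_finite[OF \<open>q \<noteq> 0\<close>] finite_subset by blast
qed

section \<open>Linear relations and counting of monomials\<close>

lemma homogeneous_system_nontrivial:
  fixes a :: "'w \<Rightarrow> 'u \<Rightarrow> 'k::field"
  assumes "finite W" "finite U" "card W < card U"
  shows "\<exists>c. (\<exists>u\<in>U. c u \<noteq> 0) \<and> (\<forall>w\<in>W. (\<Sum>u\<in>U. a w u * c u) = 0)"
  using assms
proof (induction W arbitrary: U a rule: finite_induct)
  case empty
  then obtain u where "u \<in> U" by fastforce
  then show ?case by (intro exI[of _ "\<lambda>_. 1"]) auto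
next
  case (insert w W)
  show ?case
  proof (cases "\<forall>u\<in>U. a w u = 0")
    case True
    have "card W < card U" using insert by simp
    from insert.IH[OF insert.prems(1) this, of a] show ?thesis using True by auto
  next
    case False
    then obtain v where v: "v \<in> U" "a w v \<noteq> 0" by blast
    have "card W < card (U - {v})" using insert v by simp
    then obtain c where c: "\<exists>u\<in>U - {v}. c u \<noteq> 0"
      "\<And>w'. w' \<in> W \<Longrightarrow> (\<Sum>u\<in>U - {v}. (a w' u - a w' v * a w u / a w v) * c u) = 0"
      using insert.IH[of "U - {v}" "\<lambda>w' u. a w' u - a w' v * a w u / a w v"] insert.prems(1) by auto
    define t where "t = (\<Sum>u\<in>U - {v}. a w u * c u)"
    \<comment> \<open>Gaussian elimination with pivot \<open>a w v\<close>: the value at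
      \<open>v\<close> is the one dictated by equation \<open>w\<close>.\<close>
    define d where "d = c(v := - t / a w v)"
    have d: "(\<Sum>u\<in>U. a w' u * d u) = (\<Sum>u\<in>U - {v}. a w' u * c u) - a w' v * t / a w v" for w'
    proof -
      have "(\<Sum>u\<in>U. a w' u * d u) = a w' v * d v + (\<Sum>u\<in>U - {v}. a w' u * d u)"
        using insert.prems(1) v(1) by (simp add: sum.remove)
      also have "(\<Sum>u\<in>U - {v}. a w' u * d u) = (\<Sum>u\<in>U - {v}. a w' u * c u)"
        by (intro sum.cong) (auto simp: d_def)
      finally show ?thesis by (simp add: d_def)
    qed
    show ?thesis
    proof (intro exI[of _ d] conjI ballI)
      show "\<exists>u\<in>U. d u \<noteq> 0" using c(1) unfolding d_def by auto
      fix w' assume "w' \<in> insert w W"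
      then show "(\<Sum>u\<in>U. a w' u * d u) = 0"
      proof
        assume "w' = w"
        then show ?thesis unfolding d using v(2) by (simp add: t_def)
      next
        assume "w' \<in> W"
        have "(\<Sum>u\<in>U. a w' u * d u) = (\<Sum>u\<in>U - {v}. (a w' u - a w' v * a w u / a w v) * c u)"
          unfolding d t_def
          by (simp add: sum_subtractf left_diff_distrib sum_distrib_left sum_divide_distrib mult.assoc)
        then show ?thesis using c(2)[OF \<open>w' \<in> W\<close>] by simp
      qed
    qed
  qed
qed

text \<open>Comparing coefficients turns a relation into \<open>card W\<close> equations in
  \<open>card U\<close> unknowns.\<close>

lemma mpoly_linear_relation:
  fixes h :: "'u \<Rightarrow> 'k::field mpoly"
  assumes "finite W" "finite U" "card W < card U" and h: "\<And>i. i \<in> U \<Longrightarrow> Poly_Mapping.keys (h i) \<subseteq> W"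
  shows "\<exists>c. (\<exists>i\<in>U. c i \<noteq> 0) \<and> (\<Sum>i\<in>U. mconst (c i) * h i) = 0"
proof -
  obtain c where c: "\<exists>i\<in>U. c i \<noteq> 0" "\<forall>w\<in>W. (\<Sum>i\<in>U. Poly_Mapping.lookup (h i) w * c i) = 0"
    using homogeneous_system_nontrivial[OF assms(1-3), of "\<lambda>w i. Poly_Mapping.lookup (h i) w"] by blast
  have "(\<Sum>i\<in>U. mconst (c i) * h i) = 0"
  proof (rule poly_mapping_eqI)
    fix w
    have *: "Poly_Mapping.lookup (\<Sum>i\<in>U. mconst (c i) * h i) w = (\<Sum>i\<in>U. Poly_Mapping.lookup (h i) w * c i)"
      by (simp add: lookup_sum lookup_mconst_mult mult.commute[of "Poly_Mapping.lookup _ _"])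
    show "Poly_Mapping.lookup (\<Sum>i\<in>U. mconst (c i) * h i) w = Poly_Mapping.lookup 0 w"
    proof (cases "w \<in> W")
      case False
      then have "Poly_Mapping.lookup (h i) w = 0" if "i \<in> U" for i
        using h[OF that] by (auto simp: in_keys_iff)
      then show ?thesis unfolding * by simp
    qed (use c(2) * in simp)
  qed
  with c(1) show ?thesis by blast
qed

text \<open>Bounding every exponent separately, instead of the total degree, makes the count exactly
  \<open>k ^ n\<close>.\<close>

definition exponent_box :: "nat \<Rightarrow> nat \<Rightarrow> (nat \<Rightarrow>\<^sub>0 nat) set" where
  "exponent_box n k = {u. Poly_Mapping.keys u \<subseteq> {1..n} \<and> (\<forall>i\<in>{1..n}. Poly_Mapping.lookup u i < k)}"

lemma exponent_box_finite_card: "finite (exponent_box n k)" "card (exponent_box n k) = k ^ n"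
proof -
  let ?g = "\<lambda>e. \<Sum>i\<in>{1..n}. Poly_Mapping.single i (e i :: nat)"
  have lk: "Poly_Mapping.lookup (?g e) j = (if j \<in> {1..n} then e j else 0)" for e j
    unfolding lookup_sum lookup_single when_def by (simp add: sum.delta)
  have "bij_betw ?g (PiE {1..n} (\<lambda>_. {..<k})) (exponent_box n k)"
  proof (rule bij_betwI')
    fix e e' assume e: "e \<in> PiE {1..n} (\<lambda>_. {..<k})" "e' \<in> PiE {1..n} (\<lambda>_. {..<k})"
    show "?g e = ?g e' \<longleftrightarrow> e = e'"
    proof
      assume "?g e = ?g e'"
      then have "e j = e' j" if "j \<in> {1..n}" for j
        using lk[of e j] lk[of e' j] that by simp
      then show "e = e'" using e by (intro PiE_ext) auto
    qed simp
  next
    fix e assume e: "e \<in> PiE {1..n} (\<lambda>_. {..<k})"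
    show "?g e \<in> exponent_box n k"
      unfolding exponent_box_def using e lk[of e]
      by (auto simp: in_keys_iff PiE_def Pi_def simp del: lookup_sum split: if_splits)
  next
    fix u assume u: "u \<in> exponent_box n k"
    have "u = ?g (restrict (Poly_Mapping.lookup u) {1..n})"
      using u by (intro poly_mapping_eqI) (auto simp only: lk exponent_box_def in_keys_iff mem_Collect_eq subset_iff restrict_def split: if_splits)
    moreover have "restrict (Poly_Mapping.lookup u) {1..n} \<in> PiE {1..n} (\<lambda>_. {..<k})"
      using u unfolding exponent_box_def by auto
    ultimately show "\<exists>e\<in>PiE {1..n} (\<lambda>_. {..<k}). u = ?g e" by blast
  qed
  then show "finite (exponent_box n k)" "card (exponent_box n k) = k ^ n"
    using bij_betw_finite[of ?g "PiE {1..n} (\<lambda>_. {..<k})"] bij_betw_same_card[of ?g "PiE {1..n} (\<lambda>_. {..<k})"]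
    by (auto simp: finite_PiE card_PiE)
qed

definition bounded_exps :: "nat \<Rightarrow> nat \<Rightarrow> ('k::comm_ring_1) mpoly \<Rightarrow> bool" where
  "bounded_exps n k p \<longleftrightarrow> Poly_Mapping.keys p \<subseteq> exponent_box n (Suc k)"

lemma bounded_exps_mono: "bounded_exps n k p \<Longrightarrow> k \<le> l \<Longrightarrow> bounded_exps n l p"
  unfolding bounded_exps_def exponent_box_def by fastforce

lemma bounded_exps_1: "bounded_exps n 0 1"
  unfolding bounded_exps_def exponent_box_def by auto

lemma bounded_exps_mult:
  assumes "bounded_exps n k p" "bounded_exps n l q"
  shows "bounded_exps n (k + l) (p * q)"
  unfolding bounded_exps_def
proof
  fix u assume "u \<in> Poly_Mapping.keys (p * q)"
  then obtain v w where vw: "v \<in> Poly_Mapping.keys p" "w \<in> Poly_Mapping.keys q" "u = v + w"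
    using Poly_Mapping.keys_mult[of p q] by auto
  then have "v \<in> exponent_box n (Suc k)" "w \<in> exponent_box n (Suc l)"
    using assms unfolding bounded_exps_def by auto
  then show "u \<in> exponent_box n (Suc (k + l))"
    unfolding exponent_box_def vw(3) using Poly_Mapping.keys_add[of v w]
    by (fastforce simp: lookup_add)
qed

lemma bounded_exps_power: "bounded_exps n k p \<Longrightarrow> bounded_exps n (j * k) (p ^ j)"
  by (induction j) (auto simp: bounded_exps_1 intro: bounded_exps_mult)

lemma bounded_exps_prod:
  "finite X \<Longrightarrow> (\<And>i. i \<in> X \<Longrightarrow> bounded_exps n (k i) (p i)) \<Longrightarrow> bounded_exps n (\<Sum>i\<in>X. k i) (prod p X)"
  by (induction X rule: finite_induct) (auto simp: bounded_exps_1 intro: bounded_exps_mult)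

lemma bounded_exps_exists:
  assumes "p \<in> mpolys n"
  shows "\<exists>k. bounded_exps n k p"
proof -
  define k where "k = (\<Sum>u\<in>Poly_Mapping.keys p. \<Sum>i\<in>{1..n}. Poly_Mapping.lookup u i)"
  have "Poly_Mapping.lookup u i < Suc k" if "u \<in> Poly_Mapping.keys p" "i \<in> {1..n}" for u i
  proof -
    have "Poly_Mapping.lookup u i \<le> (\<Sum>i\<in>{1..n}. Poly_Mapping.lookup u i)"
      using that by (intro member_le_sum) auto
    also have "\<dots> \<le> k" unfolding k_def
      using that by (intro member_le_sum[of u _ "\<lambda>u. \<Sum>i\<in>{1..n}. Poly_Mapping.lookup u i"]) auto
    finally show ?thesis by simp
  qed
  then have "bounded_exps n k p"
    using assms unfolding bounded_exps_def exponent_box_def mpolys_def by auto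
  then show ?thesis by blast
qed

text \<open>There are \<open>k\<^sup>n\<^sup>+\<^sup>1\<close> monomials in the \<open>f i\<close> with exponents below \<open>k\<close>, and they lie in a space of
  dimension \<open>O(k\<^sup>n)\<close>.\<close>

lemma algebraic_relation_exists:
  fixes f :: "nat \<Rightarrow> 'k::field mpoly"
  assumes f: "\<And>i. i \<in> {1..Suc n} \<Longrightarrow> f i \<in> mpolys n"
  shows "\<exists>G\<in>mpolys (Suc n). G \<noteq> 0 \<and> meval f G = 0"
proof -
  have "\<forall>i\<in>{1..Suc n}. \<exists>k. bounded_exps n k (f i)"
    using f bounded_exps_exists by blast
  then obtain D' where D': "\<And>i. i \<in> {1..Suc n} \<Longrightarrow> bounded_exps n (D' i) (f i)"
    by metis
  define D where "D = (\<Sum>i\<in>{1..Suc n}. D' i)"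
  have D: "bounded_exps n D (f i)" if "i \<in> {1..Suc n}" for i
    by (rule bounded_exps_mono[OF D'[OF that]], unfold D_def, rule member_le_sum) (use that in auto)
  \<comment> \<open>A monomial in the \<open>f i\<close> with exponents below \<open>k\<close> has
    exponents at most \<open>l\<close> in each variable. From \<open>Suc l <= k * E\<close> follows
    \<open>Suc l ^ n <= k ^ n * E ^ n\<close>, and \<open>k\<close> is taken just above
    \<open>E ^ n\<close> to make this less than \<open>k ^ Suc n\<close>.\<close>
  define E where "E = Suc n * D + 1"
  define k where "k = E ^ n + 1"
  define l where "l = Suc n * (k * D)"
  let ?U = "exponent_box (Suc n) k"
  let ?W = "exponent_box n (Suc l)"
  have "Suc l \<le> k * E" unfolding l_def E_def k_def by (simp add: algebra_simps)
  then have "Suc l ^ n \<le> k ^ n * E ^ n" using power_mono[of "Suc l" "k * E" n] by (simp add: power_mult_distrib)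
  also have "\<dots> < k ^ n * k" unfolding k_def by simp
  finally have card: "card ?W < card ?U" by (simp add: exponent_box_finite_card mult.commute)
  have "Poly_Mapping.keys (meval_mon f u) \<subseteq> ?W" if u: "u \<in> ?U" for u
  proof -
    have "meval_mon f u = (\<Prod>i\<in>{1..Suc n}. f i ^ Poly_Mapping.lookup u i)"
      using u unfolding exponent_box_def by (intro meval_mon_superset) auto
    moreover have "bounded_exps n (\<Sum>i\<in>{1..Suc n}. Poly_Mapping.lookup u i * D) (\<Prod>i\<in>{1..Suc n}. f i ^ Poly_Mapping.lookup u i)"
      using D by (intro bounded_exps_prod bounded_exps_power) auto
    moreover have "(\<Sum>i\<in>{1..Suc n}. Poly_Mapping.lookup u i * D) \<le> l"
    proof -
      have "(\<Sum>i\<in>{1..Suc n}. Poly_Mapping.lookup u i * D) \<le> (\<Sum>i\<in>{1..Suc n}. k * D)"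
        using u unfolding exponent_box_def by (intro sum_mono mult_right_mono) (auto intro: less_imp_le)
      then show ?thesis unfolding l_def by simp
    qed
    ultimately have "bounded_exps n l (meval_mon f u)" using bounded_exps_mono by metis
    then show ?thesis unfolding bounded_exps_def .
  qed
  then obtain c where c: "\<exists>u\<in>?U. c u \<noteq> 0" "(\<Sum>u\<in>?U. mconst (c u) * meval_mon f u) = 0"
    using mpoly_linear_relation[OF exponent_box_finite_card(1,1) card, of "meval_mon f"] by blast
  define G where "G = (\<Sum>u\<in>?U. Poly_Mapping.single u (c u))"
  have lk: "Poly_Mapping.lookup G v = (if v \<in> ?U then c v else 0)" for v
    unfolding G_def lookup_sum lookup_single when_def
    using exponent_box_finite_card(1)[of "Suc n" k] by (simp add: sum.delta)
  have "Poly_Mapping.keys G \<subseteq> ?U" using lk by (auto simp: in_keys_iff split: if_splits)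
  then have "G \<in> mpolys (Suc n)" unfolding mpolys_def exponent_box_def by blast
  moreover have "G \<noteq> 0"
  proof
    assume "G = 0"
    with lk have "(if v \<in> ?U then c v else 0) = 0" for v by (metis lookup_zero)
    with c(1) show False by metis
  qed
  moreover have "meval f G = 0"
    unfolding G_def meval_sum meval_single using c(2) .
  ultimately show ?thesis by blast
qed

section \<open>Transcendence degree and height\<close>

text \<open>Algebraic independence over \<open>K\<close> of the residues of
  \<open>f 1, ..., f d\<close> in \<open>R / P\<close>, with the quotient replaced by membership in
  \<open>P\<close>.\<close>

definition alg_indep :: "nat \<Rightarrow> ('k::comm_ring_1) mpoly set \<Rightarrow> nat \<Rightarrow> (nat \<Rightarrow> 'k mpoly) \<Rightarrow> bool" where
  "alg_indep n P d f \<longleftrightarrow> (\<forall>i\<in>{1..d}. f i \<in> mpolys n) \<and> (\<forall>G\<in>mpolys d. meval f G \<in> P \<longrightarrow> G = 0)"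

text \<open>Families are taken in \<open>R / P\<close> itself rather than in its fraction field. For
  a prime \<open>P\<close> the set contains \<open>0\<close> and is bounded by \<open>n\<close>, so
  the maximum is attained.\<close>

definition trdeg :: "nat \<Rightarrow> ('k::comm_ring_1) mpoly set \<Rightarrow> nat" where
  "trdeg n P = Max {d. \<exists>f. alg_indep n P d f}"

lemma alg_indep_0:
  fixes P :: "'k::field mpoly set"
  assumes "prime_in (mpolys n) P"
  shows "alg_indep n P 0 f"
  unfolding alg_indep_def
proof (intro conjI ballI impI)
  fix G :: "'k mpoly" assume G: "G \<in> mpolys 0" "meval f G \<in> P"
  from G(1) obtain c where c: "G = mconst c" by (rule mpolys_0E)
  show "G = 0"
  proof (rule ccontr)
    assume "G \<noteq> 0"
    then have "mconst (inverse c) * mconst c = 1" using c mconst_inverse_mult by auto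
    moreover have "mconst (inverse c) * mconst c \<in> P"
      using ideal_inD(5)[OF prime_inD(1)[OF assms], of "mconst (inverse c)" "mconst c"] G(2) c by simp
    ultimately show False using prime_inD(2)[OF assms] by simp
  qed
qed auto

lemma alg_indep_bound:
  fixes P :: "'k::field mpoly set"
  assumes P: "prime_in (mpolys n) P" and f: "alg_indep n P d f"
  shows "d \<le> n"
proof (rule ccontr)
  assume d: "\<not> d \<le> n"
  then have "f i \<in> mpolys n" if "i \<in> {1..Suc n}" for i
    using f that unfolding alg_indep_def by auto
  from algebraic_relation_exists[of n f, OF this] obtain G where G: "G \<in> mpolys (Suc n)" "G \<noteq> 0" "meval f G = 0"
    by blast
  moreover have "G \<in> mpolys d" using G(1) mpolys_mono[of "Suc n" d] d by auto
  ultimately show False using f ideal_inD(3)[OF prime_inD(1)[OF P]] unfolding alg_indep_def by auto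
qed

lemma
  fixes P :: "'k::field mpoly set"
  assumes P: "prime_in (mpolys n) P"
  shows trdeg_le: "trdeg n P \<le> n"
    and alg_indep_trdeg: "\<exists>f. alg_indep n P (trdeg n P) f"
    and trdeg_ge: "alg_indep n P d f \<Longrightarrow> d \<le> trdeg n P"
proof -
  have sub: "{d. \<exists>f. alg_indep n P d f} \<subseteq> {..n}" using alg_indep_bound[OF P] by auto
  have fin: "finite {d. \<exists>f. alg_indep n P d f}" using finite_subset[OF sub] by simp
  have ne: "{d. \<exists>f. alg_indep n P d f} \<noteq> {}" using alg_indep_0[OF P] by blast
  have "trdeg n P \<in> {d. \<exists>f. alg_indep n P d f}"
    unfolding trdeg_def using Max_in[OF fin ne] .
  then show "trdeg n P \<le> n" "\<exists>f. alg_indep n P (trdeg n P) f" using sub by auto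
  show "alg_indep n P d f \<Longrightarrow> d \<le> trdeg n P"
    unfolding trdeg_def by (intro Max_ge[OF fin]) blast
qed

lemma meval_poly_mvar:
  assumes "q \<in> polys_over (mpolys d)"
  shows "meval (f(Suc d := h)) (poly q (mvar (Suc d))) = poly (map_poly (meval f) q) h"
  using assms
proof (induction q)
  case (pCons a q)
  then have a: "a \<in> mpolys d" and q: "q \<in> polys_over (mpolys d)" by (simp_all add: pCons_in_polys_over_iff)
  have "meval (f(Suc d := h)) a = meval f a" using a by (rule meval_cong) auto
  moreover have "meval (f(Suc d := h)) (mvar (Suc d)) = h" by simp
  ultimately show ?case using pCons.IH[OF q] by (simp add: map_poly_pCons del: fun_upd_apply)
qed simp

lemma trdeg_strict_antimono:
  fixes P Q :: "'k::field mpoly set"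
  assumes P: "prime_in (mpolys n) P" and Q: "prime_in (mpolys n) Q" and PQ: "P \<subset> Q"
  shows "trdeg n Q < trdeg n P"
proof -
  obtain f where f: "alg_indep n Q (trdeg n Q) f" using alg_indep_trdeg[OF Q] by blast
  define d where "d = trdeg n Q"
  obtain h where h: "h \<in> Q" "h \<notin> P" using PQ by blast
  note idP = prime_inD(1)[OF P] and idQ = prime_inD(1)[OF Q]
  have hA: "h \<in> mpolys n" using ideal_inD(2)[OF idQ h(1)] .
  have fA: "f i \<in> mpolys n" if "i \<in> {1..d}" for i using f that unfolding alg_indep_def d_def by auto
  \<comment> \<open>Coefficients are peeled off in Horner form: \<open>h\<close> in \<open>Q\<close>
    forces the constant coefficient to vanish, and \<open>h\<close> outside \<open>P\<close> then
    allows cancelling \<open>h\<close>.\<close>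
  have zero: "q = 0" if "q \<in> polys_over (mpolys d)" "poly (map_poly (meval f) q) h \<in> P" for q
    using that
  proof (induction q)
    case (pCons a q)
    then have a: "a \<in> mpolys d" and q: "q \<in> polys_over (mpolys d)" by (simp_all add: pCons_in_polys_over_iff)
    let ?r = "poly (map_poly (meval f) q) h"
    have cf: "meval f (coeff q k) \<in> mpolys n" for k
      using q fA unfolding polys_over_def by (intro meval_in_mpolys[of _ d]) auto
    have rA: "?r \<in> mpolys n" unfolding poly_altdef
      using cf hA by (intro is_subring_sum[OF is_subring_mpolys] is_subringD(5,7)[OF is_subring_mpolys])
        (auto simp: coeff_map_poly)
    have in_P: "meval f a + h * ?r \<in> P" using pCons.prems(2) by (simp add: map_poly_pCons)
    have "h * ?r \<in> Q" using ideal_inD(6)[OF idQ rA h(1)] by simp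
    then have "meval f a \<in> Q" using in_P PQ ideal_in_add_cancel[OF is_subring_mpolys idQ] by blast
    then have a0: "a = 0" using f a unfolding alg_indep_def d_def by blast
    then have "h * ?r \<in> P" using in_P by simp
    then have "?r \<in> P" using prime_inD(3)[OF P hA rA] h(2) by blast
    then show ?case using pCons.IH[OF q] a0 by simp
  qed simp
  have "alg_indep n P (Suc d) (f(Suc d := h))"
    unfolding alg_indep_def
  proof (intro conjI ballI impI)
    fix i assume "i \<in> {1..Suc d}"
    then show "(f(Suc d := h)) i \<in> mpolys n" using hA fA[of i] by (cases "i = Suc d") auto
  next
    fix G :: "'k mpoly" assume G: "G \<in> mpolys (Suc d)" "meval (f(Suc d := h)) G \<in> P"
    then obtain q where q: "q \<in> polys_over (mpolys d)" "G = poly q (mvar (Suc d))"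
      unfolding mpolys_Suc ring_ext_def by blast
    then show "G = 0" using zero[OF q(1)] G(2) meval_poly_mvar[OF q(1)] by (simp del: fun_upd_apply)
  qed
  then show ?thesis using trdeg_ge[OF P] unfolding d_def by fastforce
qed

section \<open>Extension and contraction of primes along one new variable\<close>

definition ideal_ext :: "nat \<Rightarrow> ('k::comm_ring_1) mpoly set \<Rightarrow> 'k mpoly set" where
  "ideal_ext n p = (\<lambda>q. poly q (mvar (Suc n))) ` polys_over p"

lemma poly_mvar_inj:
  fixes q r :: "'k::field_char_0 mpoly poly"
  assumes "q \<in> polys_over (mpolys n)" "r \<in> polys_over (mpolys n)" "poly q (mvar (Suc n)) = poly r (mvar (Suc n))"
  shows "q = r"
proof -
  have "q - r \<in> polys_over (mpolys n)"
    using is_subringD(6)[OF is_subring_polys_over[OF is_subring_mpolys] assms(1,2)] .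
  then show ?thesis using poly_mvar_eq_0D[of "q - r" n] assms(3) by simp
qed

lemma poly_mvar_in_ideal_ext_iff:
  fixes q :: "'k::field_char_0 mpoly poly"
  assumes "ideal_in (mpolys n) p" "q \<in> polys_over (mpolys n)"
  shows "poly q (mvar (Suc n)) \<in> ideal_ext n p \<longleftrightarrow> q \<in> polys_over p"
proof
  assume "poly q (mvar (Suc n)) \<in> ideal_ext n p"
  then obtain r where r: "r \<in> polys_over p" "poly q (mvar (Suc n)) = poly r (mvar (Suc n))"
    unfolding ideal_ext_def by auto
  have "r \<in> polys_over (mpolys n)" using r(1) ideal_inD(1)[OF assms(1)] unfolding polys_over_def by auto
  then show "q \<in> polys_over p" using poly_mvar_inj[OF assms(2)] r by blast
qed (auto simp: ideal_ext_def)

lemma ideal_ext_Int_mpolys: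
  fixes p :: "'k::field_char_0 mpoly set"
  assumes "ideal_in (mpolys n) p" "a \<in> mpolys n"
  shows "a \<in> ideal_ext n p \<longleftrightarrow> a \<in> p"
proof -
  have "[:a:] \<in> polys_over (mpolys n)" "[:a:] \<in> polys_over p \<longleftrightarrow> a \<in> p"
    using assms(2) is_subringD(1)[OF is_subring_mpolys, of n] ideal_inD(3)[OF assms(1)]
    by (auto simp: pCons_in_polys_over_iff) (auto simp: polys_over_def)
  then show ?thesis using poly_mvar_in_ideal_ext_iff[OF assms(1), of "[:a:]"] by simp
qed

text \<open>Gauss's lemma: look at the lowest coefficients outside \<open>p\<close>.\<close>

lemma prime_in_polys_over:
  assumes A: "is_subring A" and p: "prime_in A p"
  shows "prime_in (polys_over A) (polys_over p)"
  unfolding prime_in_def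
proof (intro conjI ballI impI)
  note idp = prime_inD(1)[OF p]
  show "ideal_in (polys_over A) (polys_over p)" using ideal_in_polys_over[OF idp] .
  show "1 \<notin> polys_over p" using prime_inD(2)[OF p] by (auto simp: polys_over_def dest: spec[of _ 0])
  fix q r assume q: "q \<in> polys_over A" and r: "r \<in> polys_over A" and qr: "q * r \<in> polys_over p"
  show "q \<in> polys_over p \<or> r \<in> polys_over p"
  proof (rule ccontr)
    assume "\<not> ?thesis"
    then have ex: "\<exists>i. coeff q i \<notin> p" "\<exists>i. coeff r i \<notin> p" unfolding polys_over_def by auto
    define i where "i = (LEAST i. coeff q i \<notin> p)"
    define j where "j = (LEAST j. coeff r j \<notin> p)"
    have i: "coeff q i \<notin> p" "\<And>k. k < i \<Longrightarrow> coeff q k \<in> p"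
      unfolding i_def using LeastI_ex[OF ex(1)] not_less_Least by blast+
    have j: "coeff r j \<notin> p" "\<And>k. k < j \<Longrightarrow> coeff r k \<in> p"
      unfolding j_def using LeastI_ex[OF ex(2)] not_less_Least by blast+
    have cA: "coeff q k \<in> A" "coeff r k \<in> A" for k using q r unfolding polys_over_def by auto
    have "(\<Sum>k\<in>{..i + j} - {i}. coeff q k * coeff r (i + j - k)) \<in> p"
    proof (rule ideal_in_sum[OF idp])
      fix k assume k: "k \<in> {..i + j} - {i}"
      then have "k < i \<or> i + j - k < j" by auto
      then show "coeff q k * coeff r (i + j - k) \<in> p"
        using i(2) j(2) ideal_inD(5,6)[OF idp] cA by blast
    qed
    moreover have "coeff (q * r) (i + j) = coeff q i * coeff r j + (\<Sum>k\<in>{..i + j} - {i}. coeff q k * coeff r (i + j - k))"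
      unfolding coeff_mult by (subst sum.remove[of _ i]) auto
    moreover have "coeff (q * r) (i + j) \<in> p" using qr unfolding polys_over_def by auto
    ultimately have "coeff q i * coeff r j \<in> p" using ideal_in_add_cancel[OF A idp] by metis
    then show False using prime_inD(3)[OF p cA] i(1) j(1) by blast
  qed
qed

text \<open>Evaluation at the new variable identifies the formal polynomials over
  \<open>mpolys n\<close> with \<open>mpolys (Suc n)\<close> and carries \<open>polys_over p\<close>
  to \<open>ideal_ext n p\<close>; Gauss's lemma is transported along it.\<close>

lemma prime_in_ideal_ext:
  fixes p :: "'k::field_char_0 mpoly set"
  assumes p: "prime_in (mpolys n) p"
  shows "prime_in (mpolys (Suc n)) (ideal_ext n p)"
proof -
  note A = is_subring_mpolys[of n]
  note idp = prime_inD(1)[OF p]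
  note PP = prime_in_polys_over[OF A p]
  note idPP = prime_inD(1)[OF PP]
  note iff = poly_mvar_in_ideal_ext_iff[OF idp]
  note S = is_subringD[OF is_subring_polys_over[OF A]]
  have sub: "polys_over p \<subseteq> polys_over (mpolys n)" using ideal_inD(1)[OF idPP] .
  show ?thesis unfolding prime_in_def ideal_in_def
  proof (intro conjI ballI impI)
    show "ideal_ext n p \<subseteq> mpolys (Suc n)"
      unfolding ideal_ext_def mpolys_Suc ring_ext_def using sub by blast
    show "0 \<in> ideal_ext n p" using iff[of 0] S(1) ideal_inD(3)[OF idPP] by simp
    show "1 \<notin> ideal_ext n p" using iff[of 1] S(2) prime_inD(2)[OF PP] by simp
  next
    fix x y assume "x \<in> ideal_ext n p" "y \<in> ideal_ext n p"
    then obtain q r where qr: "q \<in> polys_over p" "r \<in> polys_over p" "x = poly q (mvar (Suc n))" "y = poly r (mvar (Suc n))"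
      unfolding ideal_ext_def by blast
    then have "q + r \<in> polys_over p" using ideal_inD(4)[OF idPP] by blast
    then show "x + y \<in> ideal_ext n p" using iff[of "q + r"] sub qr by auto
  next
    fix x y :: "'k mpoly" assume "x \<in> mpolys (Suc n)" "y \<in> ideal_ext n p"
    then obtain q r where qr: "q \<in> polys_over (mpolys n)" "r \<in> polys_over p" "x = poly q (mvar (Suc n))" "y = poly r (mvar (Suc n))"
      unfolding ideal_ext_def mpolys_Suc ring_ext_def by blast
    then have "q * r \<in> polys_over p" using ideal_inD(5)[OF idPP] by blast
    then show "x * y \<in> ideal_ext n p" using iff[of "q * r"] sub qr by auto
  next
    fix x y :: "'k mpoly" assume "x \<in> mpolys (Suc n)" "y \<in> mpolys (Suc n)" and xy: "x * y \<in> ideal_ext n p"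
    then obtain q r where qr: "q \<in> polys_over (mpolys n)" "r \<in> polys_over (mpolys n)"
      "x = poly q (mvar (Suc n))" "y = poly r (mvar (Suc n))"
      unfolding mpolys_Suc ring_ext_def by blast
    then have "q * r \<in> polys_over p" using iff[OF S(5)[OF qr(1,2)]] xy by simp
    then show "x \<in> ideal_ext n p \<or> y \<in> ideal_ext n p"
      using prime_inD(3)[OF PP qr(1,2)] iff qr by blast
  qed
qed

text \<open>The new variable is added to a maximal independent family. A relation modulo the
  extended ideal holds coefficient by coefficient modulo \<open>p\<close>, so each coefficient is
  zero.\<close>

lemma trdeg_ideal_ext:
  fixes p :: "'k::field_char_0 mpoly set"
  assumes p: "prime_in (mpolys n) p"
  shows "Suc (trdeg n p) \<le> trdeg (Suc n) (ideal_ext n p)"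
proof -
  obtain f where f: "alg_indep n p (trdeg n p) f" using alg_indep_trdeg[OF p] by blast
  define d where "d = trdeg n p"
  have fA: "f i \<in> mpolys n" if "i \<in> {1..d}" for i using f that unfolding alg_indep_def d_def by auto
  have "alg_indep (Suc n) (ideal_ext n p) (Suc d) (f(Suc d := mvar (Suc n)))"
    unfolding alg_indep_def
  proof (intro conjI ballI impI)
    fix i assume "i \<in> {1..Suc d}"
    then show "(f(Suc d := mvar (Suc n))) i \<in> mpolys (Suc n)"
      using fA[of i] mpolys_mono[of n "Suc n"] mvar_in_mpolys[of "Suc n" "Suc n"] by (cases "i = Suc d") auto
  next
    fix G :: "'k mpoly" assume G: "G \<in> mpolys (Suc d)" "meval (f(Suc d := mvar (Suc n))) G \<in> ideal_ext n p"
    then obtain q where q: "q \<in> polys_over (mpolys d)" "G = poly q (mvar (Suc d))"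
      unfolding mpolys_Suc ring_ext_def by blast
    have "poly (map_poly (meval f) q) (mvar (Suc n)) \<in> ideal_ext n p"
      using G(2) meval_poly_mvar[OF q(1)] q(2) by (simp del: fun_upd_apply)
    moreover have "map_poly (meval f) q \<in> polys_over (mpolys n)"
      using q(1) fA unfolding polys_over_def
      by (auto simp: coeff_map_poly intro!: meval_in_mpolys[of _ d])
    ultimately have "map_poly (meval f) q \<in> polys_over p"
      using poly_mvar_in_ideal_ext_iff[OF prime_inD(1)[OF p]] by blast
    then have "coeff q k = 0" for k
      using f q(1) unfolding alg_indep_def d_def polys_over_def by (auto simp: coeff_map_poly)
    then have "q = 0" by (simp add: poly_eq_iff)
    then show "G = 0" using q(2) by simp
  qed
  then show ?thesis using trdeg_ge[OF prime_in_ideal_ext[OF p]] unfolding d_def by blast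
qed

text \<open>A family independent modulo the contraction stays independent modulo \<open>P\<close>,
  since its polynomial expressions lie in \<open>mpolys n\<close>.\<close>

lemma trdeg_contract:
  fixes P :: "'k::field mpoly set"
  assumes P: "prime_in (mpolys (Suc n)) P"
  shows "prime_in (mpolys n) (P \<inter> mpolys n)" "trdeg n (P \<inter> mpolys n) \<le> trdeg (Suc n) P"
proof -
  have sub: "mpolys n \<subseteq> (mpolys (Suc n) :: 'k mpoly set)" using mpolys_mono[of n "Suc n"] by simp
  show p: "prime_in (mpolys n) (P \<inter> mpolys n)"
    using prime_in_Int_subring[OF P is_subring_mpolys sub] .
  obtain f where f: "alg_indep n (P \<inter> mpolys n) (trdeg n (P \<inter> mpolys n)) f" using alg_indep_trdeg[OF p] by blast
  have "alg_indep (Suc n) P (trdeg n (P \<inter> mpolys n)) f"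
    unfolding alg_indep_def
  proof (intro conjI ballI impI)
    fix G :: "'k mpoly" assume G: "G \<in> mpolys (trdeg n (P \<inter> mpolys n))" "meval f G \<in> P"
    have "meval f G \<in> mpolys n"
      using f unfolding alg_indep_def by (intro meval_in_mpolys[OF G(1)]) auto
    then show "G = 0" using f G unfolding alg_indep_def by blast
  qed (use f sub in \<open>auto simp: alg_indep_def\<close>)
  then show "trdeg n (P \<inter> mpolys n) \<le> trdeg (Suc n) P" using trdeg_ge[OF P] by blast
qed

section \<open>Chains of primes\<close>

definition prime_chain :: "nat \<Rightarrow> nat \<Rightarrow> (nat \<Rightarrow> ('k::comm_ring_1) mpoly set) \<Rightarrow> bool" where
  "prime_chain n k c \<longleftrightarrow> (\<forall>i\<le>k. prime_in (mpolys n) (c i)) \<and> (\<forall>i<k. c i \<subset> c (Suc i))"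

lemma prime_chain_extend:
  assumes "prime_chain n k c" "prime_in (mpolys n) P" "c k \<subset> P"
  shows "prime_chain n (Suc k) (c(Suc k := P))"
  using assms unfolding prime_chain_def by (auto simp: le_Suc_eq less_Suc_eq)

text \<open>Upper half of the height formula: every step of a chain lowers the transcendence degree,
  which starts at \<open>n\<close> or below.\<close>

lemma prime_chain_trdeg:
  fixes c :: "nat \<Rightarrow> 'k::field mpoly set"
  assumes "prime_chain n k c"
  shows "k + trdeg n (c k) \<le> n"
proof -
  have "i + trdeg n (c i) \<le> trdeg n (c 0)" if "i \<le> k" for i
    using that
  proof (induction i)
    case (Suc i)
    then have "trdeg n (c (Suc i)) < trdeg n (c i)"
      using assms unfolding prime_chain_def by (intro trdeg_strict_antimono) auto
    with Suc show ?case by simp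
  qed simp
  from this[of k] show ?thesis
    using trdeg_le[of n "c 0"] assms unfolding prime_chain_def by fastforce
qed

text \<open>A prime \<open>P\<close> of \<open>A[x]\<close> lies over \<open>p = P \<inter> A\<close>. Either \<open>P\<close> is the extension of \<open>p\<close>, whose
  transcendence degree is one more than that of \<open>p\<close>, or it strictly contains that extension, which
  lengthens the chain by one.\<close>

lemma prime_chain_exists:
  fixes P :: "'k::field_char_0 mpoly set"
  assumes "prime_in (mpolys n) P"
  shows "\<exists>k c. prime_chain n k c \<and> c k = P \<and> n \<le> k + trdeg n P"
  using assms
proof (induction n arbitrary: P)
  case 0
  then show ?case by (intro exI[of _ 0] exI[of _ "\<lambda>_. P"]) (auto simp: prime_chain_def)
next
  case (Suc n)
  define p where "p = P \<inter> mpolys n"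
  note p = trdeg_contract[OF Suc.prems, folded p_def]
  note E = prime_in_ideal_ext[OF p(1)]
  obtain k c where c: "prime_chain n k c" "c k = p" "n \<le> k + trdeg n p" using Suc.IH[OF p(1)] by blast
  have ext: "prime_chain (Suc n) k (\<lambda>i. ideal_ext n (c i))"
    unfolding prime_chain_def
  proof (intro conjI allI impI)
    show "prime_in (mpolys (Suc n)) (ideal_ext n (c i))" if "i \<le> k" for i
      using c(1) that prime_in_ideal_ext unfolding prime_chain_def by blast
    fix i assume i: "i < k"
    then have ci: "prime_in (mpolys n) (c i)" "prime_in (mpolys n) (c (Suc i))" "c i \<subset> c (Suc i)"
      using c(1) unfolding prime_chain_def by auto
    have "ideal_ext n (c i) \<subseteq> ideal_ext n (c (Suc i))"
      using ci(3) unfolding ideal_ext_def polys_over_def by auto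
    \<comment> \<open>A polynomial constant in the new variable already separates the two
      extensions.\<close>
    moreover obtain a where "a \<in> c (Suc i)" "a \<notin> c i" using ci(3) by blast
    then have "a \<in> ideal_ext n (c (Suc i))" "a \<notin> ideal_ext n (c i)"
      using ideal_ext_Int_mpolys[OF prime_inD(1)[OF ci(1)]] ideal_ext_Int_mpolys[OF prime_inD(1)[OF ci(2)]]
        ideal_inD(2)[OF prime_inD(1)[OF ci(2)]] by blast+
    ultimately show "ideal_ext n (c i) \<subset> ideal_ext n (c (Suc i))" by blast
  qed
  have sub: "ideal_ext n p \<subseteq> P"
    using poly_in_ideal[OF is_subring_mpolys, of n "mvar (Suc n)" P p] prime_inD(1)[OF Suc.prems]
    unfolding mpolys_Suc ideal_ext_def p_def by auto
  show ?case
  proof (cases "ideal_ext n p = P")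
    case True
    then have "Suc n \<le> k + trdeg (Suc n) P" using c(3) trdeg_ideal_ext[OF p(1)] by simp
    then show ?thesis using ext c(2) True by blast
  next
    case False
    then have "prime_chain (Suc n) (Suc k) ((\<lambda>i. ideal_ext n (c i))(Suc k := P))"
      using prime_chain_extend[OF ext Suc.prems] sub c(2) by auto
    moreover have "Suc n \<le> Suc k + trdeg (Suc n) P" using c(3) p(2) by simp
    ultimately show ?thesis by (metis fun_upd_same)
  qed
qed

section \<open>Primes above a given prime\<close>

text \<open>Over an uncountable field this replaces Krull's principal ideal theorem. If \<open>P + (x - c)\<close>,
  with \<open>x = f (Suc d)\<close>, meets \<open>K[f 1, \<dots>, f d] - {0}\<close>, then \<open>h\<^sub>c (x - c) \<equiv> b\<^sub>c\<close> modulo \<open>P\<close> for some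
  \<open>b\<^sub>c \<noteq> 0\<close> not involving \<open>x\<close>. As the polynomial ring has countable dimension, uncountably many
  \<open>h\<^sub>c = b\<^sub>c / (x - c)\<close> could not be linearly independent; but they are, by looking at the poles.\<close>

lemma countable_bad_translates:
  fixes P :: "'k::field_char_0 mpoly set"
  assumes P: "prime_in (mpolys n) P" and f: "alg_indep n P (Suc d) f"
  shows "countable {c. adjoin (mpolys n) P (f (Suc d) - mconst c) \<inter> meval f ` (mpolys d - {0}) \<noteq> {}}"
proof -
  define B where "B = {c. adjoin (mpolys n) P (f (Suc d) - mconst c) \<inter> meval f ` (mpolys d - {0}) \<noteq> {}}"
  let ?x = "f (Suc d)"
  note idP = prime_inD(1)[OF P] and A = is_subringD[OF is_subring_mpolys[of n]]
  have fA: "f i \<in> mpolys n" if "i \<in> {1..Suc d}" for i using f that unfolding alg_indep_def by auto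
  have "\<exists>h b. h \<in> mpolys n \<and> b \<in> mpolys d \<and> b \<noteq> 0 \<and> meval f b - h * (?x - mconst c) \<in> P" if c: "c \<in> B" for c
  proof -
    obtain b where b: "b \<in> mpolys d" "b \<noteq> 0" "meval f b \<in> adjoin (mpolys n) P (?x - mconst c)"
      using c unfolding B_def by auto
    then obtain p h where "meval f b = p + h * (?x - mconst c)" "p \<in> P" "h \<in> mpolys n"
      unfolding adjoin_def by auto
    then show ?thesis using b by (intro exI[of _ h] exI[of _ b]) simp
  qed
  then obtain h b where hb: "\<And>c. c \<in> B \<Longrightarrow> h c \<in> mpolys n" "\<And>c. c \<in> B \<Longrightarrow> b c \<in> mpolys d"
    "\<And>c. c \<in> B \<Longrightarrow> b c \<noteq> 0" "\<And>c. c \<in> B \<Longrightarrow> meval f (b c) - h c * (?x - mconst c) \<in> P"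
    by metis
  \<comment> \<open>The polynomials with exponents at most \<open>k\<close> form a
    finite-dimensional space, so infinitely many \<open>h c\<close> in it would satisfy a linear
    relation.\<close>
  have "finite {c\<in>B. bounded_exps n k (h c)}" (is "finite ?D") for k
  proof (rule ccontr)
    assume "infinite ?D"
    then obtain U where U: "U \<subseteq> ?D" "finite U" "card U = Suc (card (exponent_box n (Suc k)))"
      using infinite_arbitrarily_large by metis
    have UB: "c \<in> B" if "c \<in> U" for c using U(1) that by auto
    have "Poly_Mapping.keys (h c) \<subseteq> exponent_box n (Suc k)" if "c \<in> U" for c
      using U(1) that unfolding bounded_exps_def by auto
    then obtain \<beta> where \<beta>: "\<exists>c\<in>U. \<beta> c \<noteq> 0" "(\<Sum>c\<in>U. mconst (\<beta> c) * h c) = 0"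
      using mpoly_linear_relation[OF exponent_box_finite_card(1) U(2), of n "Suc k" h] U(3) by auto
    \<comment> \<open>The same combination of the fractions \<open>b c / (X - c)\<close>, with
      \<open>X\<close> the last variable and the denominators cleared.\<close>
    define G where "G = (\<Sum>c\<in>U. mconst (\<beta> c) * b c * (\<Prod>c'\<in>U - {c}. mvar (Suc d) - mconst c'))"
    have bSuc: "b c \<in> mpolys (Suc d)" if "c \<in> U" for c
      using hb(2)[OF UB[OF that]] mpolys_mono[of d "Suc d"] by auto
    have "G \<in> mpolys (Suc d)" unfolding G_def
      using bSuc by (intro is_subring_sum is_subring_prod is_subring_mpolys is_subringD(5,6)[OF is_subring_mpolys] mvar_in_mpolys) auto
    moreover have "meval f G \<in> P"
    proof -
      define R where "R c = (\<Prod>c'\<in>U - {c}. ?x - mconst c')" for c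
      have RA: "R c \<in> mpolys n" for c unfolding R_def
        using fA by (intro is_subring_prod is_subring_mpolys A(6)) auto
      have R: "(?x - mconst c) * R c = (\<Prod>c'\<in>U. ?x - mconst c')" if "c \<in> U" for c
        unfolding R_def using U(2) that by (simp add: prod.remove)
      have "meval f G = (\<Sum>c\<in>U. mconst (\<beta> c) * meval f (b c) * R c)"
        unfolding G_def R_def by (simp add: meval_sum meval_prod)
      \<comment> \<open>Modulo \<open>P\<close>, replacing \<open>meval f (b c)\<close> by
        \<open>h c * (x - c)\<close> turns each summand into a multiple of \<open>h c\<close> by one
        common product, so that the linear relation applies.\<close>
      also have "\<dots> = (\<Sum>c\<in>U. (mconst (\<beta> c) * R c) * (meval f (b c) - h c * (?x - mconst c))
          + (mconst (\<beta> c) * h c) * ((?x - mconst c) * R c))"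
        by (intro sum.cong refl) (simp only: algebra_simps)
      also have "\<dots> = (\<Sum>c\<in>U. (mconst (\<beta> c) * R c) * (meval f (b c) - h c * (?x - mconst c)))
          + (\<Sum>c\<in>U. mconst (\<beta> c) * h c) * (\<Prod>c'\<in>U. ?x - mconst c')"
        by (simp add: sum.distrib R sum_distrib_right)
      also have "\<dots> = (\<Sum>c\<in>U. (mconst (\<beta> c) * R c) * (meval f (b c) - h c * (?x - mconst c)))"
        using \<beta>(2) by simp
      also have "\<dots> \<in> P"
        using hb(4) UB RA by (intro ideal_in_sum[OF idP] ideal_inD(5)[OF idP] A(5)) auto
      finally show ?thesis .
    qed
    ultimately have "G = 0" using f unfolding alg_indep_def by blast
    obtain c0 where c0: "c0 \<in> U" "\<beta> c0 \<noteq> 0" using \<beta>(1) by blast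
    \<comment> \<open>Evaluation at the pole \<open>c0\<close>: every summand except the one for
      \<open>c0\<close> has a factor that vanishes there.\<close>
    let ?s = "mvar(Suc d := mconst c0)"
    have s_b: "meval ?s (b c) = b c" if "c \<in> U" for c
    proof -
      have "meval ?s (b c) = meval mvar (b c)"
        using hb(2)[OF UB[OF that]] by (rule meval_cong) auto
      then show ?thesis using meval_mvar_id[OF hb(2)[OF UB[OF that]]] by simp
    qed
    have "meval ?s G = (\<Sum>c\<in>U. mconst (\<beta> c) * b c * (\<Prod>c'\<in>U - {c}. mconst c0 - mconst c'))"
      unfolding G_def meval_sum using s_b by (intro sum.cong refl) (simp add: meval_prod del: fun_upd_apply, simp)
    also have "\<dots> = mconst (\<beta> c0) * b c0 * (\<Prod>c'\<in>U - {c0}. mconst c0 - mconst c')"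
    proof -
      have "(\<Prod>c'\<in>U - {c}. mconst c0 - mconst c') = 0" if "c \<in> U - {c0}" for c
        using U(2) c0(1) that by (intro prod_zero) auto
      then have "(\<Sum>c\<in>U - {c0}. mconst (\<beta> c) * b c * (\<Prod>c'\<in>U - {c}. mconst c0 - mconst c')) = 0"
        by (intro sum.neutral ballI) (simp only: mult_zero_right)
      then show ?thesis by (subst sum.remove[OF U(2) c0(1)]) (simp only: add_0_right)
    qed
    finally have "mconst (\<beta> c0) * b c0 * (\<Prod>c'\<in>U - {c0}. mconst c0 - mconst c') = 0"
      using \<open>G = 0\<close> by simp
    moreover have "(\<Prod>c'\<in>U - {c0}. mconst c0 - mconst c') \<noteq> 0"
      using U(2) by (auto simp: prod_zero_iff)
    ultimately show False using c0 hb(3)[OF UB[OF c0(1)]] by simp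
  qed
  then have "countable (\<Union>k. {c\<in>B. bounded_exps n k (h c)})"
    by (intro countable_UN) (auto intro: countable_finite)
  moreover have "B \<subseteq> (\<Union>k. {c\<in>B. bounded_exps n k (h c)})"
  proof
    fix c assume c: "c \<in> B"
    with bounded_exps_exists[OF hb(1)[OF c]] show "c \<in> (\<Union>k. {c\<in>B. bounded_exps n k (h c)})" by blast
  qed
  ultimately show ?thesis using countable_subset unfolding B_def by blast
qed

text \<open>For all but countably many \<open>c\<close>, the ideal \<open>P + (x - c)\<close> misses
  the nonzero polynomials in \<open>f 1, ..., f d\<close>. A prime over it that still misses them
  has transcendence degree at least \<open>d\<close>, and less than \<open>d + 1\<close> because it
  strictly contains \<open>P\<close>. Distinct \<open>c\<close> give distinct primes: a common one
  would contain a nonzero constant.\<close>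

theorem uncountably_many_primes_above:
  fixes P :: "'k::field_char_0 mpoly set"
  assumes K: "uncountable (UNIV :: 'k set)" and P: "prime_in (mpolys n) P" and tr: "1 \<le> trdeg n P"
  shows "uncountable {Q. prime_in (mpolys n) Q \<and> P \<subset> Q \<and> Suc (trdeg n Q) = trdeg n P}"
proof -
  obtain d where d: "trdeg n P = Suc d" using tr by (cases "trdeg n P") auto
  obtain f where f: "alg_indep n P (Suc d) f" using alg_indep_trdeg[OF P] d by metis
  let ?M = "meval f ` (mpolys d - {0})"
  define x where "x = f (Suc d)"
  define J where "J c = adjoin (mpolys n) P (x - mconst c)" for c
  note idP = prime_inD(1)[OF P] and A = is_subringD[OF is_subring_mpolys[of n]]
  have xA: "x - mconst c \<in> mpolys n" for c
    using f A(6)[of "f (Suc d)" "mconst c"] unfolding alg_indep_def x_def by simp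
  have M1: "1 \<in> ?M" using is_subringD(2)[OF is_subring_mpolys[of d]] by (intro image_eqI[of _ _ 1]) auto
  have Mmult: "a * b \<in> ?M" if ab: "a \<in> ?M" "b \<in> ?M" for a b
  proof -
    obtain u v where uv: "u \<in> mpolys d" "u \<noteq> 0" "a = meval f u" "v \<in> mpolys d" "v \<noteq> 0" "b = meval f v"
      using ab by auto
    then show ?thesis
      using is_subringD(5)[OF is_subring_mpolys uv(1,4)] by (intro image_eqI[of _ _ "u * v"]) auto
  qed
  have notP: "x - mconst c \<notin> P" for c
  proof
    assume "x - mconst c \<in> P"
    moreover have "mvar (Suc d) - mconst c \<in> mpolys (Suc d)"
      by (intro is_subringD(6)[OF is_subring_mpolys] mvar_in_mpolys) auto
    ultimately have "mvar (Suc d) - mconst c = 0"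
      using f unfolding alg_indep_def x_def by fastforce
    \<comment> \<open>The value at \<open>c + 1\<close> is \<open>1\<close>, so the polynomial
      cannot be zero.\<close>
    then have "meval (\<lambda>_. mconst (c + 1)) (mvar (Suc d) - mconst c) = 0" by simp
    then show False by (simp del: meval_diff add: meval_diff[of _ "mvar _"])
  qed
  define good where "good = {c. J c \<inter> ?M = {}}"
  have "\<exists>Q. prime_in (mpolys n) Q \<and> J c \<subseteq> Q \<and> Q \<inter> ?M = {}" if "c \<in> good" for c
  proof -
    have J: "ideal_in (mpolys n) (J c)" "J c \<inter> ?M = {}"
      using ideal_in_adjoin[OF is_subring_mpolys idP xA] that unfolding good_def J_def by auto
    obtain Q where "prime_in (mpolys n) Q" "J c \<subseteq> Q" "Q \<inter> ?M = {}"
      by (rule exists_prime_avoiding[OF is_subring_mpolys noetherian_in_mpolys J(1) M1 _ J(2)])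
        (rule Mmult)
    then show ?thesis by (intro exI[of _ Q] conjI)
  qed
  then obtain Q where Q: "\<And>c. c \<in> good \<Longrightarrow> prime_in (mpolys n) (Q c)" "\<And>c. c \<in> good \<Longrightarrow> J c \<subseteq> Q c"
    "\<And>c. c \<in> good \<Longrightarrow> Q c \<inter> ?M = {}"
    by metis
  have xQ: "x - mconst c \<in> Q c" and PQ: "P \<subset> Q c" if "c \<in> good" for c
    using Q(2)[OF that] adjoin_superset[OF is_subring_mpolys idP, of "x - mconst c"] notP[of c]
    unfolding J_def by blast+
  have "Suc (trdeg n (Q c)) = trdeg n P" if c: "c \<in> good" for c
  proof -
    have "alg_indep n (Q c) d f"
      using f Q(3)[OF c] unfolding alg_indep_def by auto
    then have "d \<le> trdeg n (Q c)" using trdeg_ge[OF Q(1)[OF c]] by blast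
    then show ?thesis using trdeg_strict_antimono[OF P Q(1)[OF c] PQ[OF c]] d by simp
  qed
  then have sub: "Q ` good \<subseteq> {Q. prime_in (mpolys n) Q \<and> P \<subset> Q \<and> Suc (trdeg n Q) = trdeg n P}"
    using Q(1) PQ by blast
  have inj: "inj_on Q good"
  proof (rule inj_onI, rule ccontr)
    fix c c' assume c: "c \<in> good" "c' \<in> good" "Q c = Q c'" "c \<noteq> c'"
    note idQ = prime_inD(1)[OF Q(1)[OF c(1)]]
    have "(x - mconst c) - (x - mconst c') \<in> Q c"
      using ideal_in_diff[OF is_subring_mpolys idQ] xQ c by metis
    then have "mconst (c' - c) \<in> Q c" by simp
    then have "mconst (inverse (c' - c)) * mconst (c' - c) \<in> Q c"
      using ideal_inD(5)[OF idQ mconst_in_mpolys] by blast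
    then have "1 \<in> Q c" using c(4) mconst_inverse_mult[of "c' - c"] by (simp del: mconst_simps(5))
    then show False using prime_inD(2)[OF Q(1)[OF c(1)]] by simp
  qed
  have "countable (- good)"
    using countable_bad_translates[OF P f] unfolding good_def J_def x_def Compl_eq by simp
  then have "uncountable good"
    using K countable_Un[of good "- good"] by auto
  then have "uncountable (Q ` good)" using countable_image_inj_on inj by blast
  then show ?thesis using sub countable_subset by blast
qed

section \<open>Exhaustion of the spectrum\<close>

lemma carrier_mpoly_ring: "carrier (mpoly_ring n) = mpolys n"
  by (simp add: mpolys_def)

lemma ideal_mpoly_ring_iff: "ideal I (mpoly_ring n) \<longleftrightarrow> ideal_in (mpolys n) I"
proof
  assume "ideal I (mpoly_ring n)"
  then interpret ideal I "mpoly_ring n" .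
  show "ideal_in (mpolys n) I"
    using a_subset zero_closed a_closed I_l_closed additive_subgroup.zero_closed[OF is_additive_subgroup]
      additive_subgroup.a_closed[OF is_additive_subgroup]
    unfolding ideal_in_def carrier_mpoly_ring by simp
next
  assume I: "ideal_in (mpolys n) I"
  interpret R: cring "mpoly_ring n :: 'a mpoly ring" by (rule cring_mpoly_ring)
  show "ideal I (mpoly_ring n)"
  proof (rule idealI[OF R.ring_axioms])
    have "inv\<^bsub>add_monoid (mpoly_ring n)\<^esub> x = - x" if "x \<in> I" for x
    proof -
      have "\<ominus>\<^bsub>mpoly_ring n\<^esub> x = - x"
        using ideal_inD(2)[OF I that] is_subringD(3)[OF is_subring_mpolys]
        by (intro R.minus_equality) (auto simp: carrier_mpoly_ring simp del: mpoly_ring_simps(1))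
      then show ?thesis by (simp add: a_inv_def)
    qed
    then show "subgroup I (add_monoid (mpoly_ring n))"
      using ideal_inD[OF I] ideal_in_uminus[OF is_subring_mpolys I]
      by (auto simp: subgroup_def carrier_mpoly_ring simp del: mpoly_ring_simps(1))
  qed (use ideal_inD[OF I] in \<open>auto simp: carrier_mpoly_ring simp del: mpoly_ring_simps(1)\<close>)
qed

lemma Spec_mpoly_ring: "P \<in> Spec (mpoly_ring n) \<longleftrightarrow> prime_in (mpolys n) P"
proof -
  have one: "1 \<in> P \<longleftrightarrow> mpolys n = P" if "ideal_in (mpolys n) P"
    using ideal_inD(1)[OF that] ideal_inD(5)[OF that, of _ 1] is_subringD(2)[OF is_subring_mpolys[of n]] by force
  have "primeideal P (mpoly_ring n) \<longleftrightarrow> prime_in (mpolys n) P"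
    unfolding primeideal_def primeideal_axioms_def ideal_mpoly_ring_iff prime_in_def
    using cring_mpoly_ring one by (auto simp: carrier_mpoly_ring simp del: mpoly_ring_simps(1))
  then show ?thesis by (simp add: Spec_def)
qed

text \<open>The transcendence degree bounds the length of every chain ending in \<open>P\<close>,
  and one chain attains the bound.\<close>

lemma height_mpoly_ring:
  fixes P :: "'k::field_char_0 mpoly set"
  assumes P: "prime_in (mpolys n) P"
  shows "height (mpoly_ring n) P = enat (n - trdeg n P)"
proof -
  have eq: "height (mpoly_ring n) P = Sup {enat k | k. \<exists>c. prime_chain n k c \<and> c k = P}"
    unfolding height_def prime_chain_def Spec_mpoly_ring by (simp add: conj_assoc)
  obtain k c where k: "prime_chain n k c" "c k = P" "n \<le> k + trdeg n P" using prime_chain_exists[OF P] by blast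
  have le: "j \<le> n - trdeg n P" if "prime_chain n j c" "c j = P" for j c
    using prime_chain_trdeg[OF that(1)] that(2) by simp
  have "k = n - trdeg n P" using le[OF k(1,2)] k(3) by simp
  show ?thesis unfolding eq
  proof (rule antisym)
    show "Sup {enat k | k. \<exists>c. prime_chain n k c \<and> c k = P} \<le> enat (n - trdeg n P)"
      using le by (intro Sup_least) auto
    show "enat (n - trdeg n P) \<le> Sup {enat k | k. \<exists>c. prime_chain n k c \<and> c k = P}"
      using k(1,2) \<open>k = n - trdeg n P\<close>
      by (intro Sup_upper CollectI exI[of _ k] conjI exI[of _ c]) simp_all
  qed
qed

text \<open>Written as a sum to avoid truncated subtraction; raising the height by one then reads as
  lowering the transcendence degree by one.\<close>

lemma Spec_ht_mpoly_ring:
  fixes P :: "'k::field_char_0 mpoly set"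
  shows "P \<in> Spec_ht (mpoly_ring n) g \<longleftrightarrow> prime_in (mpolys n) P \<and> g + trdeg n P = n"
  using height_mpoly_ring[of n P] trdeg_le[of n P]
  by (auto simp: Spec_ht_def Spec_mpoly_ring)

lemma nat_pow_mpoly_ring: "a [^]\<^bsub>mpoly_ring n\<^esub> (k::nat) = a ^ k"
  by (induction k) (simp_all add: nat_pow_def mult.commute)

text \<open>Take \<open>F = {{0}}\<close> and \<open>trdeg\<close> as rank: every prime of
  \<open>R\<close> lies over \<open>{0}\<close>, whose rank in \<open>m - 1\<close> variables is
  below \<open>m\<close>, so \<open>m\<close> elements suffice for every prime containing them to
  contain \<open>P\<close>. If no power of some \<open>a\<close> in \<open>P\<close> were in
  \<open>J\<close>, a prime over \<open>J\<close> avoiding these powers would contradict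
  this.\<close>

lemma prime_is_radical_of_m_elements:
  fixes P :: "'k::field_char_0 mpoly set"
  assumes P: "prime_in (mpolys m) P" and m: "1 \<le> m"
  shows "\<exists>f. (\<forall>j\<in>{1..m}. f j \<in> mpolys m) \<and>
    P = ideal_radical (mpoly_ring m) (Idl\<^bsub>mpoly_ring m\<^esub> (f ` {1..m}))"
proof -
  obtain n where n: "m = Suc n" using m by (cases m) auto
  interpret R: cring "mpoly_ring m :: 'k mpoly ring" by (rule cring_mpoly_ring)
  note A = is_subring_mpolys[of m] and idP = prime_inD(1)[OF P]
  have zero: "prime_in (mpolys n) ({0} :: 'k mpoly set)"
    using is_subringD(1)[OF is_subring_mpolys[of n]] unfolding prime_in_def ideal_in_def by auto
  have zero_rk: "prime_in (mpolys n) p \<and> trdeg n p < Suc n" if "p \<in> {{0}}" for p :: "'k mpoly set"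
    using zero trdeg_le[OF zero] that by (simp add: less_Suc_eq_le)
  have "\<exists>f. (\<forall>j\<in>{1..Suc n}. f j \<in> P) \<and> (\<forall>Q. prime_in (mpolys (Suc n)) Q \<longrightarrow>
    (\<exists>p\<in>{{0}}. p \<subseteq> Q) \<longrightarrow> (\<forall>j\<in>{1..Suc n}. f j \<in> Q) \<longrightarrow> P \<subseteq> Q)"
    unfolding mpolys_Suc
    by (rule eisenbud_evans_storch[OF is_subring_mpolys noetherian_in_mpolys idP[unfolded n mpolys_Suc]
      trdeg_strict_antimono _ zero_rk]) simp_all
  then obtain f where f_all: "(\<forall>j\<in>{1..Suc n}. f j \<in> P) \<and> (\<forall>Q. prime_in (mpolys (Suc n)) Q \<longrightarrow>
    (\<exists>p\<in>{{0}}. p \<subseteq> Q) \<longrightarrow> (\<forall>j\<in>{1..Suc n}. f j \<in> Q) \<longrightarrow> P \<subseteq> Q)"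
    by (rule exE)
  note f = conjunct1[OF f_all, folded n] conjunct2[OF f_all, folded n, rule_format]
  have fA: "f ` {1..m} \<subseteq> carrier (mpoly_ring m)"
    unfolding carrier_mpoly_ring using f(1) ideal_inD(1)[OF idP] by auto
  define J where "J = Idl\<^bsub>mpoly_ring m\<^esub> (f ` {1..m})"
  have J: "ideal_in (mpolys m) J"
    using R.genideal_ideal[OF fA] unfolding J_def ideal_mpoly_ring_iff .
  have JP: "J \<subseteq> P"
    unfolding J_def using f(1) idP by (intro R.genideal_minimal) (auto simp: ideal_mpoly_ring_iff)
  have fJ: "f j \<in> J" if "j \<in> {1..m}" for j
    using R.genideal_self[OF fA] that unfolding J_def by blast
  have "P = ideal_radical (mpoly_ring m) J"
  proof
    show "ideal_radical (mpoly_ring m) J \<subseteq> P"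
      unfolding ideal_radical_def carrier_mpoly_ring nat_pow_mpoly_ring
      using JP prime_in_power[OF A P] by blast
    show "P \<subseteq> ideal_radical (mpoly_ring m) J"
    proof
      fix a assume a: "a \<in> P"
      show "a \<in> ideal_radical (mpoly_ring m) J"
      proof (rule ccontr)
        assume "\<not> ?thesis"
        then have "J \<inter> range (\<lambda>k::nat. a ^ k) = {}"
          using ideal_inD(2)[OF idP a] unfolding ideal_radical_def carrier_mpoly_ring nat_pow_mpoly_ring by auto
        moreover have "1 \<in> range (\<lambda>k::nat. a ^ k)" by (rule range_eqI[of _ _ 0]) simp
        moreover have "x * y \<in> range (\<lambda>k::nat. a ^ k)"
          if "x \<in> range (\<lambda>k::nat. a ^ k)" "y \<in> range (\<lambda>k::nat. a ^ k)" for x y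
          using that by (auto simp flip: power_add)
        ultimately obtain Q where Q: "prime_in (mpolys m) Q" "J \<subseteq> Q" "Q \<inter> range (\<lambda>k::nat. a ^ k) = {}"
          using exists_prime_avoiding[OF A noetherian_in_mpolys J] by metis
        have "P \<subseteq> Q"
          using Q(2) fJ ideal_inD(3)[OF prime_inD(1)[OF Q(1)]] by (intro f(2)[OF Q(1)]) auto
        moreover have "a \<notin> Q" using Q(3) rangeI[of "\<lambda>k::nat. a ^ k" 1] by auto
        ultimately show False using a by blast
      qed
    qed
  qed
  then show ?thesis using fA unfolding J_def carrier_mpoly_ring by blast
qed

section \<open>Monotonicity and exhaustion in the degree bound\<close>

lemma H_exhausts:
  fixes P :: "'k::field_char_0 mpoly set"
  assumes P: "P \<in> Spec_ht (mpoly_ring m) g" and m: "1 \<le> m"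
  shows "\<exists>t\<ge>1. P \<in> H m g t"
proof -
  obtain f where f: "\<forall>j\<in>{1..m}. f j \<in> mpolys m"
    "P = ideal_radical (mpoly_ring m) (Idl\<^bsub>mpoly_ring m\<^esub> (f ` {1..m}))"
    using prime_is_radical_of_m_elements[OF _ m] P unfolding Spec_ht_mpoly_ring by blast
  \<comment> \<open>The sum dominates each degree; \<open>Suc\<close> keeps \<open>t\<close>
    positive when all degrees are \<open>0\<close>.\<close>
  define t where "t = Suc (\<Sum>j\<in>{1..m}. total_degree (f j))"
  have "total_degree (f j) \<le> t" if "j \<in> {1..m}" for j
    unfolding t_def using that by (intro le_SucI member_le_sum) auto
  then have "P \<in> H m g t"
    unfolding H_def carrier_mpoly_ring using P f by blast
  then show ?thesis unfolding t_def by auto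
qed

lemma H_mono: "t \<le> t' \<Longrightarrow> H m g t \<subseteq> H m g t'"
  unfolding H_def by fastforce

lemma S_subset_H: "g + 1 \<le> m \<Longrightarrow> S m g t \<subseteq> H m g t"
  using S_top[of g m t] S_step[of g m t] by (cases "g + 1 = m") auto

lemma C_mono:
  fixes P :: "'k::comm_ring_1 mpoly set"
  assumes "(S m (g + 1) t :: 'k mpoly set set) \<subseteq> S m (g + 1) t'"
  shows "C m g t P \<subseteq> C m g t' P"
  using assms unfolding C_def by blast

text \<open>Larger sets at height \<open>g + 1\<close> enlarge \<open>C\<close>, and a superset of
  an uncountable set is uncountable.\<close>

lemma S_mono:
  assumes "g + 1 \<le> m" "t \<le> t'"
  shows "(S m g t :: 'k::comm_ring_1 mpoly set set) \<subseteq> S m g t'"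
  using assms(1)
\<comment> \<open>\<open>g + 1 <= m\<close> excludes \<open>m - g = 0\<close>, so the real start
  \<open>g + 1 = m\<close> sits inside the successor case.\<close>
proof (induction "m - g" arbitrary: g)
  case (Suc k)
  show ?case
  proof (cases "g + 1 = m")
    case True
    then show ?thesis using H_mono[OF assms(2)] by (simp add: S_top)
  next
    case False
    then have g: "g + 1 < m" using Suc.prems by simp
    have sub: "(S m (g + 1) t :: 'k mpoly set set) \<subseteq> S m (g + 1) t'"
      using Suc.hyps(2) g by (intro Suc.hyps(1)) auto
    have "uncountable (C m g t' P)" if "uncountable (C m g t P)" for P :: "'k mpoly set"
      using that countable_subset[OF C_mono[OF sub]] by blast
    then show ?thesis unfolding S_step[OF g] using H_mono[OF assms(2)] by (auto dest: subsetD)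
  qed
qed simp

lemma UN_C: "(\<Union>t\<in>{1..}. C m g t P) = {Q \<in> (\<Union>t\<in>{1..}. S m (g + 1) t). P \<subset> Q}"
  unfolding C_def by blast

lemma S_exhausts:
  assumes K: "uncountable (UNIV :: 'k::field_char_0 set)" and "g + 1 \<le> m"
  shows "(\<Union>t\<in>{1..}. S m g t) = (Spec_ht (mpoly_ring m) g :: 'k mpoly set set)"
  using assms(2)
proof (induction "m - g" arbitrary: g)
  case (Suc k)
  note gm = \<open>g + 1 \<le> m\<close>
  show ?case
  proof
    show "(\<Union>t\<in>{1..}. S m g t) \<subseteq> (Spec_ht (mpoly_ring m) g :: 'k mpoly set set)"
      using S_subset_H[OF gm] unfolding H_def by blast
    show "(Spec_ht (mpoly_ring m) g :: 'k mpoly set set) \<subseteq> (\<Union>t\<in>{1..}. S m g t)"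
    proof
      fix P :: "'k mpoly set" assume P: "P \<in> Spec_ht (mpoly_ring m) g"
      obtain t0 where t0: "t0 \<ge> 1" "P \<in> H m g t0" using H_exhausts[OF P] gm by auto
      show "P \<in> (\<Union>t\<in>{1..}. S m g t)"
      proof (cases "g + 1 = m")
        case True
        then show ?thesis using t0 by (auto simp: S_top)
      next
        case False
        then have g: "g + 1 < m" using gm by simp
        have IH: "(\<Union>t\<in>{1..}. S m (g + 1) t) = (Spec_ht (mpoly_ring m) (g + 1) :: 'k mpoly set set)"
          using Suc.hyps(2) g by (intro Suc.hyps(1)) auto
        have "uncountable (\<Union>t\<in>{1..}. C m g t P)"
        proof -
          have PP: "prime_in (mpolys m) P" "g + trdeg m P = m" using P unfolding Spec_ht_mpoly_ring by auto
          \<comment> \<open>By the height formula, the primes of height \<open>g + 1\<close> above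
            \<open>P\<close> are those whose transcendence degree is one lower.\<close>
          have "(\<Union>t\<in>{1..}. C m g t P) = {Q. prime_in (mpolys m) Q \<and> P \<subset> Q \<and> Suc (trdeg m Q) = trdeg m P}"
            unfolding UN_C IH using PP(2) by (auto simp: Spec_ht_mpoly_ring)
          then show ?thesis using uncountably_many_primes_above[OF K PP(1)] PP(2) g by simp
        qed
        then obtain t1 where t1: "t1 \<ge> 1" "uncountable (C m g t1 P)"
          using countable_UN[of "{1..}" "\<lambda>t. C m g t P"] by auto
        \<comment> \<open>Membership in \<open>H\<close> holds from \<open>t0\<close> on and
          uncountability of \<open>C\<close> from \<open>t1\<close> on, both by
          monotonicity.\<close>
        define t where "t = max t0 t1"
        have "H m g t0 \<subseteq> H m g t"
          unfolding t_def by (intro H_mono) simp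
        moreover have "C m g t1 P \<subseteq> C m g t P"
          using g unfolding t_def by (intro C_mono S_mono) auto
        ultimately have "P \<in> S m g t"
          unfolding S_step[OF g] using t0(2) t1(2) countable_subset by blast
        then show ?thesis using t0(1) unfolding t_def by auto
      qed
    qed
  qed
qed simp

theorem propositionE:
  fixes m g :: nat
  assumes "uncountable (UNIV :: 'k::{alg_closed_field, field_char_0} set)"
    and "1 \<le> g" and "g + 2 \<le> m"
  shows "(\<forall>(P :: 'k mpoly set) t0. t0 \<ge> 1 \<longrightarrow> P \<in> S m g t0 \<longrightarrow>
            (\<forall>t\<ge>1. C m g t P \<subseteq> C m g (t + 1) P) \<and>
            (\<Union>t\<in>{1..}. C m g t P) = Spec_ht (mpoly_ring m) (g + 1) \<inter> V (mpoly_ring m) P) \<and>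
         (\<forall>t\<ge>1. (S m g t :: 'k mpoly set set) \<subseteq> S m g (t + 1)) \<and>
         (\<Union>t\<in>{1..}. (S m g t :: 'k mpoly set set)) = Spec_ht (mpoly_ring m) g"
proof (intro conjI allI impI)
  fix P :: "'k mpoly set" and t0 assume "P \<in> S m g t0"
  then have P: "P \<in> Spec_ht (mpoly_ring m) g"
    using S_subset_H[of g m t0] assms(3) unfolding H_def by auto
  show "C m g t P \<subseteq> C m g (t + 1) P" for t
    using assms(3) by (intro C_mono S_mono) simp_all
  have "(\<Union>t\<in>{1..}. C m g t P) = {Q \<in> Spec_ht (mpoly_ring m) (g + 1). P \<subset> Q}"
    using assms(3) by (simp only: UN_C S_exhausts[OF assms(1)])
  \<comment> \<open>\<open>V\<close> asks for inclusion and \<open>C\<close> for strict inclusion;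
    the different heights \<open>g\<close> and \<open>g + 1\<close> rule out equality.\<close>
  moreover have "P \<noteq> Q" if "Q \<in> Spec_ht (mpoly_ring m) (g + 1)" for Q
    using P that by (auto simp: Spec_ht_def)
  ultimately show "(\<Union>t\<in>{1..}. C m g t P) = Spec_ht (mpoly_ring m) (g + 1) \<inter> V (mpoly_ring m) P"
    by (auto simp: V_def Spec_ht_def)
next
  show "(S m g t :: 'k mpoly set set) \<subseteq> S m g (t + 1)" for t
    using assms(3) by (intro S_mono) simp_all
  show "(\<Union>t\<in>{1..}. (S m g t :: 'k mpoly set set)) = Spec_ht (mpoly_ring m) g"
    using assms(3) by (intro S_exhausts[OF assms(1)]) simp
qed

end
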